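(* Let $k\ge1$. The algebra $\check{\mathscr H}^{(k)}_3$ is the associative (unital) $\mathbf A$-algebra generated by $\mathcal P^{(k)}_s$, $s\in S=\{s_1,s_2\}$, with quadratic relations $$(\mathcal P^{(k)}_s)^2=[2]^k\,\mathcal P^{(k)}_s,\qquad s\in S,$$ and nonstandard braid relation $$\mathcal P^{(k)}_1F_k(\mathcal P^{(k)}_{2}\mathcal P^{(k)}_{1})=\mathcal P^{(k)}_2F_k(\mathcal P^{(k)}_{1}\mathcal P^{(k)}_{2}),$$ i.e. these relations are a complete set of defining relations.
   Context: Let $\mathbf A=\mathbb Z[u,u^{-1}]$, $[2]=u+u^{-1}$. Let $\mathscr H_3$ be the Hecke algebra of the symmetric group $\mathcal S_3$ with simple reflections $S=\{s_1,s_2\}$: the $\mathbf A$-algebra with free $\mathbf A$-basis $\{T_w:w\in\mathcal S_3\}$ and relations $T_vT_w=T_{vw}$ if $\ell(vw)=\ell(v)+\ell(w)$, $(T_s-u)(T_s+u^{-1})=0$ for $s\in S$. Put $C'_s=T_s+u^{-1}$ and $C_s=T_s-u$. For $k\ge1$, $\check{\mathscr H}^{(k)}_3$ is the unital $\mathbf A$-subalgebra of $\mathscr H_3^{\otimes k}$ (tensor product over $\mathbf A$) generated by the elements $\mathcal P^{(k)}_i:=\mathcal P^{(k)}_{s_i}$, $i=1,2$, where $$\mathcal P^{(k)}_s=\sum_{\mathbf a\in\{+,-\}^k,\ |\{i:a_i=-\}|\text{ even}} c_{a_1}\otimes\cdots\otimes c_{a_k},\qquad c_+=C'_s,\ c_-=C_s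 .$$ $T_j(x)$ is the Chebyshev polynomial of the first kind, $T_j(\cos\theta)=\cos(j\theta)$, and $a^{(j)}=T_j\big(\tfrac1{[2]}\big)$; for $1\le j\le k$ one has $[2]^ka^{(j)}\in\mathbf A$. Define $$F_k(y)=\prod_{j=1}^k\big(y-([2]^ka^{(j)})^2\big)\in\mathbf A[y].$$ *)

theory Defs
  imports
    Complex_Main
    "HOL-Library.Poly_Mapping"
    "HOL-Library.Numeral_Type"
    "HOL-Library.FuncSet"
    "HOL-Computational_Algebra.Polynomial"
    "HOL-Computational_Algebra.Fraction_Field"
    "HOL-Combinatorics.Perm"
begin

section \<open>Free algebras and presentations\<close>

datatype 'g free_monoid = Word (letters: "'g list")

instantiation free_monoid :: (type) monoid_add
begin

definition zero_free_monoid :: "'a free_monoid" where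
  "0 = Word []"

definition plus_free_monoid :: "'a free_monoid \<Rightarrow> 'a free_monoid \<Rightarrow> 'a free_monoid" where
  "v + w = Word (letters v @ letters w)"

instance
  by standard (simp_all add: zero_free_monoid_def plus_free_monoid_def)

end

text \<open>
  The free associative unital algebra on \<^typ>\<open>'g\<close> is the monoid algebra of the free monoid;
  multiplication on \<^typ>\<open>'g free_monoid \<Rightarrow>\<^sub>0 'r\<close> is convolution.
\<close>

type_synonym ('g, 'r) free_algebra = "'g free_monoid \<Rightarrow>\<^sub>0 'r"

lemma free_algebra_induct [case_names single add]:
  fixes p :: "('g, 'r::comm_ring_1) free_algebra"
  assumes single: "\<And>w c. P (Poly_Mapping.single w c)"
    and add: "\<And>p q. P p \<Longrightarrow> P q \<Longrightarrow> P (p + q)"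
  shows "P p"
proof (induction p rule: update_induct)
  case const
  then show ?case using single[of 0 0] by simp
next
  case (update f a b)
  have "Poly_Mapping.update a b f = f + Poly_Mapping.single a b"
    using update.hyps
    by (intro poly_mapping_eqI) (auto simp: lookup_update lookup_add lookup_single in_keys_iff when_def)
  then show ?case using add[OF update.IH single] by simp
qed

definition free_var :: "'g \<Rightarrow> ('g, 'r::comm_ring_1) free_algebra" where
  "free_var g = Poly_Mapping.single (Word [g]) 1"

definition free_scale :: "'r::comm_ring_1 \<Rightarrow> ('g, 'r) free_algebra \<Rightarrow> ('g, 'r) free_algebra" where
  "free_scale c p = Poly_Mapping.single 0 c * p"

inductive_set two_sided_ideal :: "'a::ring_1 set \<Rightarrow> 'a set" for R where
  zero: "0 \<in> two_sided_ideal R"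
| base: "x \<in> R \<Longrightarrow> x \<in> two_sided_ideal R"
| add: "x \<in> two_sided_ideal R \<Longrightarrow> y \<in> two_sided_ideal R \<Longrightarrow> x + y \<in> two_sided_ideal R"
| left: "x \<in> two_sided_ideal R \<Longrightarrow> a * x \<in> two_sided_ideal R"
| right: "x \<in> two_sided_ideal R \<Longrightarrow> x * a \<in> two_sided_ideal R"

locale unital_algebra = module scale
  for scale :: "'r::comm_ring_1 \<Rightarrow> 'a::ring_1 \<Rightarrow> 'a" +
  assumes scale_mult_left: "scale c x * y = scale c (x * y)"
    and scale_mult_right: "x * scale c y = scale c (x * y)"
begin

definition poly_eval :: "'r poly \<Rightarrow> 'a \<Rightarrow> 'a" where
  "poly_eval p x = (\<Sum>i\<le>degree p. scale (coeff p i) (x ^ i))"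

inductive_set generated_subalgebra :: "'a set \<Rightarrow> 'a set" for S where
  one: "1 \<in> generated_subalgebra S"
| base: "x \<in> S \<Longrightarrow> x \<in> generated_subalgebra S"
| add: "x \<in> generated_subalgebra S \<Longrightarrow> y \<in> generated_subalgebra S
    \<Longrightarrow> x + y \<in> generated_subalgebra S"
| mult: "x \<in> generated_subalgebra S \<Longrightarrow> y \<in> generated_subalgebra S
    \<Longrightarrow> x * y \<in> generated_subalgebra S"
| scale: "x \<in> generated_subalgebra S \<Longrightarrow> scale c x \<in> generated_subalgebra S"

text \<open>The algebra homomorphism from the free algebra sending the variable \<open>g\<close> to \<open>P g\<close>.\<close>

definition free_eval :: "('g \<Rightarrow> 'a) \<Rightarrow> ('g, 'r) free_algebra \<Rightarrow> 'a" where
  "free_eval P p = (\<Sum>w\<in>Poly_Mapping.keys p.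
     scale (Poly_Mapping.lookup p w) (prod_list (map P (letters w))))"

text \<open>
  The subset \<open>B\<close> is the algebra generated by the elements \<open>P g\<close> with defining relations
  \<open>r = 0\<close> for \<open>r \<in> R\<close>: the evaluation homomorphism maps the free algebra onto \<open>B\<close>, and its
  kernel is the two-sided ideal generated by \<open>R\<close>.
\<close>

definition has_presentation :: "'a set \<Rightarrow> ('g \<Rightarrow> 'a) \<Rightarrow> ('g, 'r) free_algebra set \<Rightarrow> bool" where
  "has_presentation B P R \<longleftrightarrow>
     range (free_eval P) = B \<and> {p. free_eval P p = 0} = two_sided_ideal R"

lemma free_eval_superset:
  assumes "finite A" "Poly_Mapping.keys p \<subseteq> A"
  shows "free_eval P p = (\<Sum>w\<in>A. scale (Poly_Mapping.lookup p w) (prod_list (map P (letters w))))"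
  unfolding free_eval_def
  by (rule sum.mono_neutral_left) (use assms in \<open>auto simp: in_keys_iff\<close>)

lemma free_eval_single:
  "free_eval P (Poly_Mapping.single w c) = scale c (prod_list (map P (letters w)))"
  by (subst free_eval_superset[where A = "{w}"]) (auto simp: lookup_single)

lemma free_eval_var: "free_eval P (free_var g) = P g"
  by (simp add: free_var_def free_eval_single)

lemma free_eval_one: "free_eval P 1 = 1"
  by (simp flip: single_one add: free_eval_single zero_free_monoid_def)

lemma free_eval_zero: "free_eval P 0 = 0"
  by (simp add: free_eval_def)

lemma free_eval_add: "free_eval P (p + q) = free_eval P p + free_eval P q"
proof -
  let ?A = "Poly_Mapping.keys p \<union> Poly_Mapping.keys q"
  have "Poly_Mapping.keys (p + q) \<subseteq> ?A"
    by (rule Poly_Mapping.keys_add)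
  then show ?thesis
    by (simp add: free_eval_superset[where A = ?A] lookup_add scale_left_distrib sum.distrib)
qed

lemma free_eval_mult: "free_eval P (p * q) = free_eval P p * free_eval P q"
proof (induction p rule: free_algebra_induct)
  case (single v c)
  show ?case
  proof (induction q rule: free_algebra_induct)
    case (single w d)
    show ?case
      by (simp add: mult_single free_eval_single plus_free_monoid_def scale_mult_left
          scale_mult_right mult.commute)
  next
    case (add p1 p2)
    then show ?case
      by (simp add: distrib_left free_eval_add)
  qed
next
  case (add p1 p2)
  then show ?case
    by (simp add: distrib_right free_eval_add)
qed

lemma free_eval_scale: "free_eval P (free_scale c p) = scale c (free_eval P p)"
  by (simp add: free_scale_def free_eval_mult free_eval_single zero_free_monoid_def
      scale_mult_left)

end

interpretation free_algebra: unital_algebra free_scale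
proof
  fix a b :: 'a and x y :: "('g, 'a) free_algebra"
  show "free_scale a (x + y) = free_scale a x + free_scale a y"
    by (simp add: free_scale_def distrib_left)
  show "free_scale (a + b) x = free_scale a x + free_scale b x"
    by (simp add: free_scale_def distrib_right single_add)
  show "free_scale a (free_scale b x) = free_scale (a * b) x"
    by (simp add: free_scale_def mult_single flip: mult.assoc)
  show "free_scale 1 x = x"
    by (simp add: free_scale_def)
  show "free_scale a x * y = free_scale a (x * y)"
    by (simp add: free_scale_def mult.assoc)
  have comm: "x * Poly_Mapping.single 0 a = Poly_Mapping.single 0 a * x"
    by (induction x rule: free_algebra_induct)
      (simp_all add: mult_single mult.commute distrib_left distrib_right)
  show "x * free_scale a y = free_scale a (x * y)"
    by (simp add: free_scale_def comm flip: mult.assoc)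
qed


section \<open>The Hecke algebra of the symmetric group on three letters\<close>

text \<open>Laurent polynomials over the integers: the group ring of the infinite cyclic group.\<close>

type_synonym laurent = "int \<Rightarrow>\<^sub>0 int"

definition u :: laurent where "u = Poly_Mapping.single 1 1"
definition u_inv :: laurent where "u_inv = Poly_Mapping.single (-1) 1"
definition two_q :: laurent where "two_q = u + u_inv"

lemma u_u_inv: "u * u_inv = 1"
  by (simp add: u_def u_inv_def mult_single)

unbundle permutation_syntax

type_synonym S3 = "3 perm"

text \<open>The points permuted are \<open>1\<close>, \<open>2\<close> and \<open>3\<close>, where \<open>3 = 0\<close> in type \<^typ>\<open>3\<close>.\<close>

datatype simple_refl = s1 | s2

fun refl_perm :: "simple_refl \<Rightarrow> S3" where
  "refl_perm s1 = \<langle>1 \<leftrightarrow> 2\<rangle>"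
| "refl_perm s2 = \<langle>2 \<leftrightarrow> 3\<rangle>"

definition word_perm :: "simple_refl list \<Rightarrow> S3" where
  "word_perm ws = prod_list (map refl_perm ws)"

definition len :: "S3 \<Rightarrow> nat" where
  "len w = (LEAST n. \<exists>ws. length ws = n \<and> word_perm ws = w)"

definition reduced_word :: "S3 \<Rightarrow> simple_refl list" where
  "reduced_word w = (SOME ws. word_perm ws = w \<and> length ws = len w)"

text \<open>
  An element \<open>\<Sum>w. x w T\<^sub>w\<close> is represented by its coefficient function.  Left multiplication
  by \<open>T\<^sub>s\<close> is given by \<open>T\<^sub>s T\<^sub>w = T\<^sub>s\<^sub>w\<close> if \<open>len (s w) > len w\<close>, and
  \<open>T\<^sub>s T\<^sub>w = T\<^sub>s\<^sub>w + (u - u_inv) T\<^sub>w\<close> otherwise; \<open>T\<^sub>v\<close> acts as the product of the \<open>T\<^sub>s\<close> along a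
  reduced word of \<open>v\<close>.  The lemmas \<open>T_mult\<close>, \<open>T_quadratic\<close> and \<open>T_basis\<close> below show that this
  is the algebra defined by the usual relations on the free basis \<open>T\<^sub>w\<close>.
\<close>

definition left_refl :: "simple_refl \<Rightarrow> (S3 \<Rightarrow> laurent) \<Rightarrow> (S3 \<Rightarrow> laurent)" where
  "left_refl s x = (\<lambda>w. x (refl_perm s * w) +
     (if len (refl_perm s * w) < len w then (u - u_inv) * x w else 0))"

definition left_T :: "S3 \<Rightarrow> (S3 \<Rightarrow> laurent) \<Rightarrow> (S3 \<Rightarrow> laurent)" where
  "left_T v = foldr left_refl (reduced_word v)"

definition hecke_mult :: "(S3 \<Rightarrow> laurent) \<Rightarrow> (S3 \<Rightarrow> laurent) \<Rightarrow> (S3 \<Rightarrow> laurent)" where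
  "hecke_mult x y = (\<lambda>w. \<Sum>v\<in>UNIV. x v * left_T v y w)"

subsection \<open>Enumeration of the group and lengths\<close>

instance perm :: (finite) finite
proof
  have "inj (apply :: 'a perm \<Rightarrow> 'a \<Rightarrow> 'a)"
    by (simp add: inj_def apply_inject)
  then show "finite (UNIV :: 'a perm set)"
    using finite_imageD[of "apply :: 'a perm \<Rightarrow> _" UNIV] by simp
qed

instance simple_refl :: finite
proof
  have "(UNIV :: simple_refl set) = {s1, s2}"
    using simple_refl.exhaust by blast
  then show "finite (UNIV :: simple_refl set)"
    by (metis finite.emptyI finite.insertI)
qed

lemma three_cases: "(x::3) = 1 \<or> x = 2 \<or> x = 3"
proof (induct x)
  case (of_int z)
  then have "0 \<le> z" "z < 3" by simp_all
  then have "z = 0 \<or> z = 1 \<or> z = 2" by presburger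
  then show ?case by (elim disjE) simp_all
qed

lemma three_neq [simp]: "(1::3) \<noteq> 2" "(2::3) \<noteq> 3" "(1::3) \<noteq> 3" "(2::3) \<noteq> 1" "(3::3) \<noteq> 2" "(3::3) \<noteq> 1"
  by simp_all

lemma S3_eq_iff: "f = (g::S3) \<longleftrightarrow> f \<langle>$\<rangle> 1 = g \<langle>$\<rangle> 1 \<and> f \<langle>$\<rangle> 2 = g \<langle>$\<rangle> 2 \<and> f \<langle>$\<rangle> 3 = g \<langle>$\<rangle> 3"
proof
  assume *: "f \<langle>$\<rangle> 1 = g \<langle>$\<rangle> 1 \<and> f \<langle>$\<rangle> 2 = g \<langle>$\<rangle> 2 \<and> f \<langle>$\<rangle> 3 = g \<langle>$\<rangle> 3"
  have "f \<langle>$\<rangle> x = g \<langle>$\<rangle> x" for x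
    using three_cases[of x] * by (elim disjE conjE) (simp_all only:)
  then show "f = g" by (rule perm_eqI)
qed (simp only: simp_thms)


lemma apply_word_perm:
  "word_perm [] \<langle>$\<rangle> x = x"
  "word_perm (s # ws) \<langle>$\<rangle> x = refl_perm s \<langle>$\<rangle> (word_perm ws \<langle>$\<rangle> x)"
  by (simp_all add: word_perm_def apply_times)

lemma apply_refl_perm:
  "refl_perm s1 \<langle>$\<rangle> 1 = 2" "refl_perm s1 \<langle>$\<rangle> 2 = 1" "refl_perm s1 \<langle>$\<rangle> 3 = 3"
  "refl_perm s2 \<langle>$\<rangle> 1 = 1" "refl_perm s2 \<langle>$\<rangle> 2 = 3" "refl_perm s2 \<langle>$\<rangle> 3 = 2"
  by (simp_all only: refl_perm.simps apply_swap_simp apply_swap_same three_neq not_False_eq_True)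

declare refl_perm.simps [simp del]

lemmas S3_compute = S3_eq_iff apply_word_perm apply_refl_perm

lemma S3_cases:
  "w \<in> word_perm ` {[], [s1], [s2], [s1,s2], [s2,s1], [s1,s2,s1]}"
proof -
  have "w \<langle>$\<rangle> 1 \<noteq> w \<langle>$\<rangle> 2" "w \<langle>$\<rangle> 2 \<noteq> w \<langle>$\<rangle> 3" "w \<langle>$\<rangle> 1 \<noteq> w \<langle>$\<rangle> 3"
    by (simp_all only: apply_inj three_neq not_False_eq_True)
  then show ?thesis
    using three_cases[of "w \<langle>$\<rangle> 1"] three_cases[of "w \<langle>$\<rangle> 2"] three_cases[of "w \<langle>$\<rangle> 3"]
    by (elim disjE) (simp_all only: image_insert image_empty insert_iff S3_compute three_neq simp_thms)
qed

lemma word_perm_neq: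
  "distinct (map word_perm [[], [s1], [s2], [s1,s2], [s2,s1], [s1,s2,s1]])"
  by (simp only: list.map distinct.simps list.set insert_iff empty_iff S3_compute three_neq simp_thms)

lemma word_perm_append: "word_perm (vs @ ws) = word_perm vs * word_perm ws"
  by (simp add: word_perm_def)

lemma word_perm_Cons: "word_perm (s # ws) = refl_perm s * word_perm ws"
  by (simp add: word_perm_def)

lemma len_le: "len (word_perm ws) \<le> length ws"
  unfolding len_def by (rule Least_le) auto

lemma reduced_word:
  "word_perm (reduced_word w) = w" "length (reduced_word w) = len w"
proof -
  from S3_cases[of w] have "\<exists>n ws. length ws = n \<and> word_perm ws = w"
    by blast
  then have "\<exists>ws. length ws = len w \<and> word_perm ws = w"
    unfolding len_def by (rule LeastI_ex)
  then have "\<exists>ws. word_perm ws = w \<and> length ws = len w"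
    by blast
  then have "word_perm (reduced_word w) = w \<and> length (reduced_word w) = len w"
    unfolding reduced_word_def by (rule someI_ex)
  then show "word_perm (reduced_word w) = w" "length (reduced_word w) = len w"
    by auto
qed

lemma len_mult_le: "len (v * w) \<le> len v + len w"
  using len_le[of "reduced_word v @ reduced_word w"] by (simp add: word_perm_append reduced_word)

lemma ex_simple_refl: "(\<exists>s. Q s) \<longleftrightarrow> Q s1 \<or> Q s2"
  using simple_refl.exhaust by metis

lemma words_by_length:
  "length ws = 0 \<longleftrightarrow> ws = []"
  "length ws = 1 \<longleftrightarrow> ws \<in> {[s1], [s2]}"
  "length ws = 2 \<longleftrightarrow> ws \<in> {[s1,s1], [s1,s2], [s2,s1], [s2,s2]}"
  "length ws = 3 \<longleftrightarrow> ws \<in> {[s1,s1,s1], [s1,s1,s2], [s1,s2,s1], [s1,s2,s2],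
    [s2,s1,s1], [s2,s1,s2], [s2,s2,s1], [s2,s2,s2]}"
  by (auto simp: numeral_2_eq_2 numeral_3_eq_3 length_Suc_conv ex_simple_refl)

lemma short_words:
  "{ws. length ws \<le> 0} = {[]}"
  "{ws. length ws \<le> 1} = {[], [s1], [s2]}"
  "{ws. length ws \<le> 2} = {[], [s1], [s2], [s1,s1], [s1,s2], [s2,s1], [s2,s2]}"
  "{ws. length ws \<le> 3} = {[], [s1], [s2], [s1,s1], [s1,s2], [s2,s1], [s2,s2],
    [s1,s1,s1], [s1,s1,s2], [s1,s2,s1], [s1,s2,s2],
    [s2,s1,s1], [s2,s1,s2], [s2,s2,s1], [s2,s2,s2]}"
proof -
  have "n \<le> 1 \<longleftrightarrow> n = 0 \<or> n = 1" "n \<le> 2 \<longleftrightarrow> n = 0 \<or> n = 1 \<or> n = 2"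
    "n \<le> 3 \<longleftrightarrow> n = 0 \<or> n = 1 \<or> n = 2 \<or> n = 3" "n \<le> 0 \<longleftrightarrow> n = 0" for n :: nat
    by presburger+
  note le = this
  show "{ws. length ws \<le> 0} = {[]}"
    "{ws. length ws \<le> 1} = {[], [s1], [s2]}"
    "{ws. length ws \<le> 2} = {[], [s1], [s2], [s1,s1], [s1,s2], [s2,s1], [s2,s2]}"
    "{ws. length ws \<le> 3} = {[], [s1], [s2], [s1,s1], [s1,s2], [s2,s1], [s2,s2],
      [s1,s1,s1], [s1,s1,s2], [s1,s2,s1], [s1,s2,s2],
      [s2,s1,s1], [s2,s1,s2], [s2,s2,s1], [s2,s2,s2]}"
    unfolding le words_by_length by blast+
qed

lemma reduced_word_in:
  "reduced_word (word_perm ws) \<in> {vs \<in> {vs. length vs \<le> length ws}. word_perm vs = word_perm ws}"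
  using len_le[of ws] by (simp add: reduced_word)

lemma filter_insert:
  "{x \<in> insert a A. Q x} = (if Q a then insert a {x \<in> A. Q x} else {x \<in> A. Q x})"
  "{x \<in> {}. Q x} = {}"
  by auto

lemmas S3_decide = S3_eq_iff apply_word_perm apply_refl_perm three_neq filter_insert if_True if_False
  simp_thms list.distinct list.inject simple_refl.distinct singleton_iff insert_iff empty_iff

lemma reduced_words:
  "reduced_word (word_perm []) = []"
  "reduced_word (word_perm [s1]) = [s1]"
  "reduced_word (word_perm [s2]) = [s2]"
  "reduced_word (word_perm [s1,s2]) = [s1,s2]"
  "reduced_word (word_perm [s2,s1]) = [s2,s1]"
  "reduced_word (word_perm [s1,s2,s1]) \<in> {[s1,s2,s1], [s2,s1,s2]}"
proof -
  have len: "length ([] :: simple_refl list) = 0" "length [a] = 1" "length [a,b] = 2"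
    "length [a,b,c] = 3" for a b c :: simple_refl
    by simp_all
  show "reduced_word (word_perm []) = []"
    using reduced_word_in[of "[]"] unfolding len short_words filter_insert
    by (simp only: S3_decide)
  show "reduced_word (word_perm [s1]) = [s1]"
    using reduced_word_in[of "[s1]"] unfolding len short_words filter_insert
    by (simp only: S3_decide)
  show "reduced_word (word_perm [s2]) = [s2]"
    using reduced_word_in[of "[s2]"] unfolding len short_words filter_insert
    by (simp only: S3_decide)
  show "reduced_word (word_perm [s1,s2]) = [s1,s2]"
    using reduced_word_in[of "[s1,s2]"] unfolding len short_words filter_insert
    by (simp only: S3_decide)
  show "reduced_word (word_perm [s2,s1]) = [s2,s1]"
    using reduced_word_in[of "[s2,s1]"] unfolding len short_words filter_insert
    by (simp only: S3_decide)
  show "reduced_word (word_perm [s1,s2,s1]) \<in> {[s1,s2,s1], [s2,s1,s2]}"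
    using reduced_word_in[of "[s1,s2,s1]"] unfolding len short_words filter_insert
    by (simp only: S3_decide)
qed

lemma len_word_perm:
  "len (word_perm []) = 0"
  "len (word_perm [s1]) = 1"
  "len (word_perm [s2]) = 1"
  "len (word_perm [s1,s2]) = 2"
  "len (word_perm [s2,s1]) = 2"
  "len (word_perm [s1,s2,s1]) = 3"
  unfolding reduced_word(2)[symmetric]
  using reduced_words(6) by (auto simp: reduced_words(1-5))

lemma word_perm_reduce:
  "word_perm [s1,s1] = word_perm []" "word_perm [s2,s2] = word_perm []"
  "word_perm [s1,s1,s2] = word_perm [s2]" "word_perm [s2,s2,s1] = word_perm [s1]"
  "word_perm [s2,s1,s2] = word_perm [s1,s2,s1]"
  "word_perm [s1,s1,s2,s1] = word_perm [s2,s1]" "word_perm [s2,s1,s2,s1] = word_perm [s1,s2]"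
  by (simp_all only: S3_decide)

lemma all_S3:
  "(\<forall>w. Q w) \<longleftrightarrow> Q (word_perm []) \<and> Q (word_perm [s1]) \<and> Q (word_perm [s2]) \<and>
     Q (word_perm [s1,s2]) \<and> Q (word_perm [s2,s1]) \<and> Q (word_perm [s1,s2,s1])"
  using S3_cases unfolding image_insert image_empty insert_iff empty_iff by metis

lemma word_perm_Nil: "word_perm [] = 1"
  by (simp add: word_perm_def)

lemma refl_refl: "refl_perm s * (refl_perm s * w) = w"
  by (cases s) (simp_all add: refl_perm.simps flip: mult.assoc)

lemma len_refl_mult_le: "len (refl_perm s * w) \<le> Suc (len w)"
  using len_le[of "s # reduced_word w"] by (simp add: word_perm_Cons reduced_word)


subsection \<open>The ring structure\<close>

lemma left_refl_table:
  "left_refl s1 x (word_perm []) = x (word_perm [s1])"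
  "left_refl s1 x (word_perm [s1]) = x (word_perm []) + (u - u_inv) * x (word_perm [s1])"
  "left_refl s1 x (word_perm [s2]) = x (word_perm [s1,s2])"
  "left_refl s1 x (word_perm [s1,s2]) = x (word_perm [s2]) + (u - u_inv) * x (word_perm [s1,s2])"
  "left_refl s1 x (word_perm [s2,s1]) = x (word_perm [s1,s2,s1])"
  "left_refl s1 x (word_perm [s1,s2,s1]) =
     x (word_perm [s2,s1]) + (u - u_inv) * x (word_perm [s1,s2,s1])"
  "left_refl s2 x (word_perm []) = x (word_perm [s2])"
  "left_refl s2 x (word_perm [s1]) = x (word_perm [s2,s1])"
  "left_refl s2 x (word_perm [s2]) = x (word_perm []) + (u - u_inv) * x (word_perm [s2])"
  "left_refl s2 x (word_perm [s1,s2]) = x (word_perm [s1,s2,s1])"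
  "left_refl s2 x (word_perm [s2,s1]) = x (word_perm [s1]) + (u - u_inv) * x (word_perm [s2,s1])"
  "left_refl s2 x (word_perm [s1,s2,s1]) =
     x (word_perm [s1,s2]) + (u - u_inv) * x (word_perm [s1,s2,s1])"
  unfolding left_refl_def word_perm_Cons[symmetric] word_perm_reduce len_word_perm
  by simp_all

lemma left_refl_quadratic:
  "left_refl s (left_refl s x) = (\<lambda>w. x w + (u - u_inv) * left_refl s x w)"
  unfolding fun_eq_iff all_S3 by (cases s) (simp_all add: left_refl_table algebra_simps)

lemma left_refl_braid:
  "left_refl s1 (left_refl s2 (left_refl s1 x)) = left_refl s2 (left_refl s1 (left_refl s2 x))"
  unfolding fun_eq_iff all_S3 by (simp add: left_refl_table algebra_simps)

lemma left_T_table: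
  "left_T (word_perm []) x = x"
  "left_T (word_perm [s1]) x = left_refl s1 x"
  "left_T (word_perm [s2]) x = left_refl s2 x"
  "left_T (word_perm [s1,s2]) x = left_refl s1 (left_refl s2 x)"
  "left_T (word_perm [s2,s1]) x = left_refl s2 (left_refl s1 x)"
  "left_T (word_perm [s1,s2,s1]) x = left_refl s1 (left_refl s2 (left_refl s1 x))"
  using reduced_words(6) by (auto simp: left_T_def reduced_words(1-5) left_refl_braid)

lemma left_refl_left_T:
  "left_refl s (left_T v x) = (\<lambda>w. left_T (refl_perm s * v) x w +
     (if len (refl_perm s * v) < len v then (u - u_inv) * left_T v x w else 0))"
proof -
  have "\<forall>v. left_refl s (left_T v x) = (\<lambda>w. left_T (refl_perm s * v) x w +
     (if len (refl_perm s * v) < len v then (u - u_inv) * left_T v x w else 0))"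
    unfolding all_S3 word_perm_Cons[symmetric]
    by (cases s) (simp_all add: word_perm_reduce len_word_perm left_T_table fun_eq_iff all_S3
        left_refl_table algebra_simps)
  then show ?thesis by blast
qed

lemma left_refl_sum:
  "left_refl s (\<lambda>w. \<Sum>i\<in>I. c i * f i w) w = (\<Sum>i\<in>I. c i * left_refl s (f i) w)"
  by (simp add: left_refl_def sum_distrib_left distrib_left sum.distrib mult.left_commute)

lemma hecke_mult_left_refl: "hecke_mult (left_refl s x) y = left_refl s (hecke_mult x y)"
proof
  fix w
  let ?d = "\<lambda>v. if len (refl_perm s * v) < len v then u - u_inv else 0"
  have "hecke_mult (left_refl s x) y w =
      (\<Sum>v\<in>UNIV. x (refl_perm s * v) * left_T v y w) + (\<Sum>v\<in>UNIV. ?d v * x v * left_T v y w)"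
    by (auto simp: hecke_mult_def left_refl_def distrib_right simp flip: sum.distrib intro: sum.cong)
  also have "(\<Sum>v\<in>UNIV. x (refl_perm s * v) * left_T v y w) =
      (\<Sum>v\<in>UNIV. x v * left_T (refl_perm s * v) y w)"
    by (rule sum.reindex_bij_witness[of _ "\<lambda>v. refl_perm s * v" "\<lambda>v. refl_perm s * v"])
      (simp_all add: refl_refl)
  also have "\<dots> + (\<Sum>v\<in>UNIV. ?d v * x v * left_T v y w) =
      (\<Sum>v\<in>UNIV. x v * left_refl s (left_T v y) w)"
    by (auto simp: left_refl_left_T algebra_simps simp flip: sum.distrib intro!: sum.cong)
  also have "\<dots> = left_refl s (hecke_mult x y) w"
    unfolding hecke_mult_def by (simp add: left_refl_sum)
  finally show "hecke_mult (left_refl s x) y w = left_refl s (hecke_mult x y) w" .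
qed

lemma hecke_mult_left_T: "hecke_mult (left_T v x) y = left_T v (hecke_mult x y)"
proof -
  have "hecke_mult (foldr left_refl ws x) y = foldr left_refl ws (hecke_mult x y)" for ws
    by (induction ws) (simp_all add: hecke_mult_left_refl)
  then show ?thesis by (simp add: left_T_def)
qed

lemma left_T_add: "left_T v (\<lambda>w. x w + y w) = (\<lambda>w. left_T v x w + left_T v y w)"
proof -
  have *: "left_refl s (\<lambda>w. x w + y w) = (\<lambda>w. left_refl s x w + left_refl s y w)" for s x y
    by (auto simp: left_refl_def algebra_simps)
  have "foldr left_refl ws (\<lambda>w. x w + y w) =
      (\<lambda>w. foldr left_refl ws x w + foldr left_refl ws y w)" for ws
    by (induction ws) (simp_all add: *)
  then show ?thesis by (simp add: left_T_def)
qed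

lemma left_T_scale: "left_T v (\<lambda>w. c * x w) = (\<lambda>w. c * left_T v x w)"
proof -
  have *: "left_refl s (\<lambda>w. c * x w) = (\<lambda>w. c * left_refl s x w)" for s x
    by (auto simp: left_refl_def algebra_simps)
  have "foldr left_refl ws (\<lambda>w. c * x w) = (\<lambda>w. c * foldr left_refl ws x w)" for ws
    by (induction ws) (simp_all add: *)
  then show ?thesis by (simp add: left_T_def)
qed

lemma left_T_delta:
  assumes "len (v * w) = len v + len w"
  shows "left_T v (\<lambda>x. if x = w then 1 else 0) = (\<lambda>x. if x = v * w then 1 else 0)"
proof -
  have *: "left_refl s (\<lambda>x. if x = w then 1 else 0) = (\<lambda>x. if x = refl_perm s * w then 1 else 0)"
    if "len w < len (refl_perm s * w)" for s w
  proof -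
    have "refl_perm s * x = w \<longleftrightarrow> x = refl_perm s * w" for x
      using refl_refl by metis
    then show ?thesis
      using that by (auto simp: left_refl_def fun_eq_iff)
  qed
  have "foldr left_refl ws (\<lambda>x. if x = w then 1 else 0) =
      (\<lambda>x. if x = word_perm ws * w then 1 else 0)"
    if "len (word_perm ws * w) = length ws + len w" for ws
    using that
  proof (induction ws)
    case Nil
    then show ?case by (simp add: word_perm_Nil)
  next
    case (Cons s ws)
    have "len (refl_perm s * (word_perm ws * w)) = Suc (length ws + len w)"
      using Cons.prems by (simp add: word_perm_Cons mult.assoc)
    moreover have "len (word_perm ws * w) \<le> length ws + len w"
      using len_mult_le[of "word_perm ws" w] len_le[of ws] by simp
    ultimately have "len (word_perm ws * w) = length ws + len w"
      using len_refl_mult_le[of s "word_perm ws * w"] by simp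
    with * Cons.IH \<open>len (refl_perm s * _) = _\<close> show ?case
      by (simp add: word_perm_Cons mult.assoc)
  qed
  from this[of "reduced_word v"] assms show ?thesis
    by (simp add: left_T_def reduced_word)
qed

typedef hecke3 = "UNIV :: (S3 \<Rightarrow> laurent) set"
  morphisms hecke_coeff Hecke ..

lemma hecke3_eqI: "(\<And>w. hecke_coeff x w = hecke_coeff y w) \<Longrightarrow> x = y"
  using hecke_coeff_inject by blast

lemma coeff_Hecke [simp]: "hecke_coeff (Hecke f) = f"
  by (simp add: Hecke_inverse)

definition T :: "S3 \<Rightarrow> hecke3" where
  "T w = Hecke (\<lambda>x. if x = w then 1 else 0)"

definition hecke_scale :: "laurent \<Rightarrow> hecke3 \<Rightarrow> hecke3" where
  "hecke_scale c x = Hecke (\<lambda>w. c * hecke_coeff x w)"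

instantiation hecke3 :: ring_1
begin

definition zero_hecke3 :: hecke3 where
  "0 = Hecke (\<lambda>_. 0)"
definition one_hecke3 :: hecke3 where
  "1 = T 1"
definition plus_hecke3 :: "hecke3 \<Rightarrow> hecke3 \<Rightarrow> hecke3" where
  "x + y = Hecke (\<lambda>w. hecke_coeff x w + hecke_coeff y w)"
definition minus_hecke3 :: "hecke3 \<Rightarrow> hecke3 \<Rightarrow> hecke3" where
  "x - y = Hecke (\<lambda>w. hecke_coeff x w - hecke_coeff y w)"
definition uminus_hecke3 :: "hecke3 \<Rightarrow> hecke3" where
  "- x = Hecke (\<lambda>w. - hecke_coeff x w)"
definition times_hecke3 :: "hecke3 \<Rightarrow> hecke3 \<Rightarrow> hecke3" where
  "x * y = Hecke (hecke_mult (hecke_coeff x) (hecke_coeff y))"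

lemmas hecke_coeff_defs =
  zero_hecke3_def one_hecke3_def plus_hecke3_def minus_hecke3_def uminus_hecke3_def
  times_hecke3_def hecke_scale_def T_def

instance
proof
  fix x y z :: hecke3
  show "x + y + z = x + (y + z)" by (simp add: hecke_coeff_defs add.assoc)
  show "x + y = y + x" by (simp add: hecke_coeff_defs add.commute)
  show "0 + x = x" by (rule hecke3_eqI) (simp add: hecke_coeff_defs)
  show "- x + x = 0" by (simp add: hecke_coeff_defs)
  show "x - y = x + - y" by (simp add: hecke_coeff_defs)
  have "hecke_coeff 0 1 \<noteq> hecke_coeff 1 1" by (simp add: hecke_coeff_defs)
  then show "(0::hecke3) \<noteq> 1" by auto
  show "x * y * z = x * (y * z)"
  proof -
    fix x y z :: "S3 \<Rightarrow> laurent"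
    have "hecke_mult (hecke_mult x y) z w = (\<Sum>v\<in>UNIV. x v * hecke_mult (left_T v y) z w)" for x y z w
      unfolding hecke_mult_def[of "hecke_mult x y"] hecke_mult_def[of "left_T _ y"]
      unfolding hecke_mult_def[of x y] sum_distrib_left sum_distrib_right
      by (subst sum.swap) (simp add: mult.assoc)
    then have "hecke_mult (hecke_mult x y) z = hecke_mult x (hecke_mult y z)" for x y z
      by (simp add: fun_eq_iff hecke_mult_left_T hecke_mult_def[of x "hecke_mult y z"])
    then show ?thesis
      by (simp add: times_hecke3_def)
  qed
  show "(x + y) * z = x * z + y * z"
    by (simp add: hecke_coeff_defs hecke_mult_def distrib_right sum.distrib)
  show "x * (y + z) = x * y + x * z"
    by (simp add: hecke_coeff_defs hecke_mult_def left_T_add distrib_left sum.distrib)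
  show "1 * x = x"
  proof (rule hecke3_eqI)
    fix w
    show "hecke_coeff (1 * x) w = hecke_coeff x w"
      using left_T_table(1)[of "hecke_coeff x"]
      by (simp add: hecke_coeff_defs hecke_mult_def if_distrib[of "\<lambda>a. a * _"] word_perm_Nil
          cong: if_cong)
  qed
  show "x * 1 = x"
  proof (rule hecke3_eqI)
    fix w
    have "left_T v (\<lambda>w. if w = 1 then 1 else 0) = (\<lambda>w. if w = v then 1 else 0)" for v
      using left_T_delta[of v 1] len_word_perm(1) by (simp add: word_perm_Nil)
    then show "hecke_coeff (x * 1) w = hecke_coeff x w"
      by (simp add: hecke_coeff_defs hecke_mult_def if_distrib[of "\<lambda>a. _ * a"] cong: if_cong)
  qed
qed

end

interpretation hecke3: unital_algebra hecke_scale
proof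
  fix a b :: laurent and x y :: hecke3
  show "hecke_scale a (x + y) = hecke_scale a x + hecke_scale a y"
    by (simp add: hecke_coeff_defs distrib_left)
  show "hecke_scale (a + b) x = hecke_scale a x + hecke_scale b x"
    by (simp add: hecke_coeff_defs distrib_right)
  show "hecke_scale a (hecke_scale b x) = hecke_scale (a * b) x"
    by (simp add: hecke_coeff_defs mult.assoc)
  show "hecke_scale 1 x = x"
    by (rule hecke3_eqI) (simp add: hecke_coeff_defs)
  show "hecke_scale a x * y = hecke_scale a (x * y)"
    by (simp add: hecke_coeff_defs hecke_mult_def sum_distrib_left mult.assoc)
  show "x * hecke_scale a y = hecke_scale a (x * y)"
    by (simp add: hecke_coeff_defs hecke_mult_def left_T_scale sum_distrib_left mult.left_commute)
qed

theorem T_mult: "len (v * w) = len v + len w \<Longrightarrow> T v * T w = T (v * w)"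
  by (simp add: times_hecke3_def T_def hecke_mult_def left_T_delta if_distrib[of "\<lambda>a. a * _"]
      cong: if_cong)

lemma hecke_coeff_sum: "hecke_coeff (sum f A) w = (\<Sum>a\<in>A. hecke_coeff (f a) w)"
  by (induction A rule: infinite_finite_induct) (simp_all add: zero_hecke3_def plus_hecke3_def)

theorem T_basis:
  "(\<Sum>w\<in>UNIV. hecke_scale (hecke_coeff x w) (T w)) = x"
  "hecke_coeff (\<Sum>w\<in>UNIV. hecke_scale (f w) (T w)) w = f w"
proof -
  show *: "hecke_coeff (\<Sum>w\<in>UNIV. hecke_scale (f w) (T w)) w = f w" for f w
    by (simp add: hecke_coeff_sum hecke_scale_def T_def if_distrib[of "\<lambda>a. _ * a"] cong: if_cong)
  show "(\<Sum>w\<in>UNIV. hecke_scale (hecke_coeff x w) (T w)) = x"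
    by (rule hecke3_eqI) (simp add: *)
qed

theorem T_quadratic:
  "(T (refl_perm s) - hecke_scale u 1) * (T (refl_perm s) + hecke_scale u_inv 1) = 0"
proof -
  let ?\<delta> = "\<lambda>v w. if w = v then 1 else (0::laurent)"
  have refl: "left_T (refl_perm s) x = left_refl s x" for x
    using left_T_table(2,3) by (cases s) (simp_all add: word_perm_def)
  have len1: "len 1 = 0"
    using len_word_perm(1) by (simp add: word_perm_Nil)
  have len_s: "len (refl_perm s) = 1"
    using len_word_perm(2,3) by (cases s) (simp_all add: word_perm_def)
  have s: "left_refl s (?\<delta> 1) = ?\<delta> (refl_perm s)"
    using left_T_delta[of "refl_perm s" 1] by (simp add: refl len1)
  have "left_refl s (?\<delta> (refl_perm s)) = (\<lambda>w. ?\<delta> 1 w + (u - u_inv) * ?\<delta> (refl_perm s) w)"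
    using left_refl_quadratic[of s "?\<delta> 1"] unfolding s .
  then have "T (refl_perm s) * T (refl_perm s) = 1 + hecke_scale (u - u_inv) (T (refl_perm s))"
    by (simp add: hecke_coeff_defs hecke_mult_def if_distrib[of "\<lambda>a. a * _"] refl cong: if_cong)
  then show ?thesis
    by (simp add: algebra_simps hecke3.scale_mult_left hecke3.scale_mult_right u_u_inv
        hecke3.scale_left_diff_distrib)
qed


section \<open>Tensor powers\<close>

text \<open>
  The tensor power of \<^typ>\<open>hecke3\<close> over the Laurent polynomials with factors indexed by the
  finite type \<^typ>\<open>'k\<close>, hence \<open>CARD('k)\<close> factors.  Being a tensor power of a free module, it is
  free on the tensors of basis elements \<open>T\<^sub>w\<close>, one for each \<open>w :: 'k \<Rightarrow> S3\<close>; an element is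
  represented by its coefficient function.  The pure tensors are multilinear (\<open>tensor_add\<close>,
  \<open>tensor_scale_component\<close>) and multiply componentwise (\<open>tensor_mult\<close>).
\<close>

typedef 'k hecke_tensor = "UNIV :: (('k \<Rightarrow> S3) \<Rightarrow> laurent) set"
  morphisms tensor_coeff Tensor ..

lemma tensor_eqI: "(\<And>w. tensor_coeff x w = tensor_coeff y w) \<Longrightarrow> x = y"
  using tensor_coeff_inject by blast

lemma coeff_Tensor [simp]: "tensor_coeff (Tensor f) = f"
  by (simp add: Tensor_inverse)

definition tensor :: "('k::finite \<Rightarrow> hecke3) \<Rightarrow> 'k hecke_tensor" where
  "tensor x = Tensor (\<lambda>w. \<Prod>i\<in>UNIV. hecke_coeff (x i) (w i))"

definition tensor_scale :: "laurent \<Rightarrow> 'k hecke_tensor \<Rightarrow> 'k hecke_tensor" where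
  "tensor_scale c x = Tensor (\<lambda>w. c * tensor_coeff x w)"

definition struct_const :: "S3 \<Rightarrow> S3 \<Rightarrow> S3 \<Rightarrow> laurent" where
  "struct_const a b c = hecke_coeff (T a * T b) c"

lemma hecke_coeff_mult:
  "hecke_coeff (x * y) c =
    (\<Sum>a\<in>UNIV. \<Sum>b\<in>UNIV. hecke_coeff x a * hecke_coeff y b * struct_const a b c)"
proof -
  have "x * y = (\<Sum>a\<in>UNIV. hecke_scale (hecke_coeff x a) (T a)) *
      (\<Sum>b\<in>UNIV. hecke_scale (hecke_coeff y b) (T b))"
    by (simp only: T_basis)
  also have "\<dots> = (\<Sum>a\<in>UNIV. \<Sum>b\<in>UNIV. hecke_scale (hecke_coeff x a * hecke_coeff y b) (T a * T b))"
    by (simp add: sum_product hecke3.scale_mult_left hecke3.scale_mult_right mult.commute)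
  finally show ?thesis
    by (simp add: hecke_coeff_sum hecke_scale_def struct_const_def)
qed

lemma struct_const_assoc:
  "(\<Sum>d\<in>UNIV. struct_const a b d * struct_const d c e) =
   (\<Sum>d\<in>UNIV. struct_const b c d * struct_const a d e)"
proof -
  have T: "hecke_coeff (T v) w = (if w = v then 1 else 0)" for v w
    by (simp add: T_def)
  have "hecke_coeff (T a * T b * T c) e = (\<Sum>d\<in>UNIV. struct_const a b d * struct_const d c e)"
    by (simp add: hecke_coeff_mult[of "T a * T b"] T if_distrib[of "\<lambda>a. _ * a"]
        if_distrib[of "\<lambda>a. a * _"] flip: struct_const_def cong: if_cong)
  moreover have "hecke_coeff (T a * (T b * T c)) e = (\<Sum>d\<in>UNIV. struct_const b c d * struct_const a d e)"
    by (subst hecke_coeff_mult, subst sum.swap)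
      (simp add: T if_distrib[of "\<lambda>a. _ * a"]
        if_distrib[of "\<lambda>a. a * _"] flip: struct_const_def cong: if_cong)
  ultimately show ?thesis
    by (simp add: mult.assoc)
qed

lemma struct_const_one:
  "struct_const 1 b c = (if c = b then 1 else 0)" "struct_const a 1 c = (if c = a then 1 else 0)"
  unfolding struct_const_def one_hecke3_def[symmetric] by (simp_all add: T_def)

lemma prod_sum_UNIV:
  fixes f :: "'i::finite \<Rightarrow> 'b::finite \<Rightarrow> 'c::comm_semiring_1"
  shows "(\<Prod>i\<in>UNIV. \<Sum>a\<in>UNIV. f i a) = (\<Sum>g\<in>UNIV. \<Prod>i\<in>UNIV. f i (g i))"
  using prod_sum_PiE[of "UNIV :: 'i set" "\<lambda>_. UNIV :: 'b set" f] by (simp add: PiE_UNIV_domain)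

lemma prod_delta:
  fixes v w :: "'i::finite \<Rightarrow> 'b"
  shows "(\<Prod>i\<in>UNIV. if w i = v i then 1 else 0) = (if w = v then 1 else (0::laurent))"
proof (cases "w = v")
  case False
  then obtain i where "w i \<noteq> v i" by blast
  then have "(\<Prod>i\<in>UNIV. if w i = v i then 1 else 0) = (0::laurent)"
    by (intro prod_zero) auto
  with False show ?thesis by simp
qed simp

instantiation hecke_tensor :: (finite) ring_1
begin

definition zero_hecke_tensor :: "'a hecke_tensor" where
  "0 = Tensor (\<lambda>_. 0)"
definition one_hecke_tensor :: "'a hecke_tensor" where
  "1 = tensor (\<lambda>_. 1)"
definition plus_hecke_tensor :: "'a hecke_tensor \<Rightarrow> 'a hecke_tensor \<Rightarrow> 'a hecke_tensor" where
  "x + y = Tensor (\<lambda>w. tensor_coeff x w + tensor_coeff y w)"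
definition minus_hecke_tensor :: "'a hecke_tensor \<Rightarrow> 'a hecke_tensor \<Rightarrow> 'a hecke_tensor" where
  "x - y = Tensor (\<lambda>w. tensor_coeff x w - tensor_coeff y w)"
definition uminus_hecke_tensor :: "'a hecke_tensor \<Rightarrow> 'a hecke_tensor" where
  "- x = Tensor (\<lambda>w. - tensor_coeff x w)"
definition times_hecke_tensor :: "'a hecke_tensor \<Rightarrow> 'a hecke_tensor \<Rightarrow> 'a hecke_tensor" where
  "x * y = Tensor (\<lambda>w. \<Sum>p\<in>UNIV. \<Sum>q\<in>UNIV. tensor_coeff x p * tensor_coeff y q *
     (\<Prod>i\<in>UNIV. struct_const (p i) (q i) (w i)))"

lemmas tensor_coeff_defs =
  zero_hecke_tensor_def plus_hecke_tensor_def minus_hecke_tensor_def uminus_hecke_tensor_def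
  times_hecke_tensor_def tensor_scale_def

lemma tensor_coeff_one: "tensor_coeff (1 :: 'a hecke_tensor) w = (if w = (\<lambda>_. 1) then 1 else 0)"
  using prod_delta[of w "\<lambda>_. 1"] by (simp add: one_hecke_tensor_def tensor_def one_hecke3_def T_def)

instance
proof
  fix x y z :: "'a hecke_tensor"
  show "x + y + z = x + (y + z)" by (simp add: tensor_coeff_defs add.assoc)
  show "x + y = y + x" by (simp add: tensor_coeff_defs add.commute)
  show "0 + x = x" by (rule tensor_eqI) (simp add: tensor_coeff_defs)
  show "- x + x = 0" by (simp add: tensor_coeff_defs)
  show "x - y = x + - y" by (simp add: tensor_coeff_defs)
  have "tensor_coeff (0 :: 'a hecke_tensor) (\<lambda>_. 1) \<noteq> tensor_coeff 1 (\<lambda>_. 1)"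
    by (simp add: tensor_coeff_one zero_hecke_tensor_def)
  then show "(0 :: 'a hecke_tensor) \<noteq> 1" by auto
  show "(x + y) * z = x * z + y * z"
    by (simp add: tensor_coeff_defs distrib_right sum.distrib)
  show "x * (y + z) = x * y + x * z"
    by (simp add: tensor_coeff_defs distrib_left distrib_right sum.distrib)
  have delta: "(if b then 1 else 0) * c = (if b then c else 0)"
    "c * (if b then 1 else 0) = (if b then c else 0)" for b and c :: laurent
    by simp_all
  have zero_times: "(if b then c else 0) * d = (if b then c * d else 0)"
    for b and c d :: laurent
    by simp
  show "1 * x = x"
  proof (rule tensor_eqI)
    fix w
    have "tensor_coeff (1 * x) w =
        (\<Sum>q\<in>UNIV. \<Sum>p\<in>UNIV. if p = (\<lambda>_. 1) then
           tensor_coeff x q * (\<Prod>i\<in>UNIV. struct_const (p i) (q i) (w i)) else 0)"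
      unfolding times_hecke_tensor_def coeff_Tensor tensor_coeff_one zero_times mult_1 mult_zero_left
      by (rule sum.swap)
    also have "\<dots> = (\<Sum>q\<in>UNIV. if w = q then tensor_coeff x q else 0)"
      unfolding sum.delta[OF finite_class.finite_UNIV] by (simp only: UNIV_I if_True struct_const_one prod_delta delta)
    finally show "tensor_coeff (1 * x) w = tensor_coeff x w"
      by simp
  qed
  show "x * 1 = x"
  proof (rule tensor_eqI)
    fix w
    have "tensor_coeff (x * 1) w =
        (\<Sum>p\<in>UNIV. \<Sum>q\<in>UNIV. if q = (\<lambda>_. 1) then
           tensor_coeff x p * (\<Prod>i\<in>UNIV. struct_const (p i) (q i) (w i)) else 0)"
      unfolding times_hecke_tensor_def coeff_Tensor tensor_coeff_one delta zero_times ..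
    also have "\<dots> = (\<Sum>p\<in>UNIV. if w = p then tensor_coeff x p else 0)"
      unfolding sum.delta[OF finite_class.finite_UNIV] by (simp only: UNIV_I if_True struct_const_one prod_delta delta)
    finally show "tensor_coeff (x * 1) w = tensor_coeff x w"
      by simp
  qed
  show "x * y * z = x * (y * z)"
  proof (rule tensor_eqI)
    fix w
    let ?x = "tensor_coeff x" and ?y = "tensor_coeff y" and ?z = "tensor_coeff z"
    let ?h = "\<lambda>p q w :: 'a \<Rightarrow> S3. \<Prod>i\<in>UNIV. struct_const (p i) (q i) (w i)"
    have assoc: "(\<Sum>d\<in>UNIV. ?h p q d * ?h d r w) = (\<Sum>d\<in>UNIV. ?h q r d * ?h p d w)" for p q r
    proof -
      have "(\<Prod>i\<in>UNIV. \<Sum>a\<in>UNIV. struct_const (p i) (q i) a * struct_const a (r i) (w i)) =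
          (\<Prod>i\<in>UNIV. \<Sum>a\<in>UNIV. struct_const (q i) (r i) a * struct_const (p i) a (w i))"
        by (simp only: struct_const_assoc)
      then show ?thesis
        unfolding prod_sum_UNIV prod.distrib .
    qed
    have "tensor_coeff (x * y * z) w =
        (\<Sum>d\<in>UNIV. \<Sum>r\<in>UNIV. \<Sum>p\<in>UNIV. \<Sum>q\<in>UNIV. ?x p * ?y q * ?z r * (?h p q d * ?h d r w))"
      by (simp add: times_hecke_tensor_def sum_distrib_left sum_distrib_right mult_ac)
    also have "\<dots> = (\<Sum>r\<in>UNIV. \<Sum>p\<in>UNIV. \<Sum>q\<in>UNIV. \<Sum>d\<in>UNIV. ?x p * ?y q * ?z r * (?h p q d * ?h d r w))"
      by (subst sum.swap, rule sum.cong[OF refl], subst sum.swap, rule sum.cong[OF refl], rule sum.swap)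
    also have "\<dots> = (\<Sum>r\<in>UNIV. \<Sum>p\<in>UNIV. \<Sum>q\<in>UNIV. \<Sum>d\<in>UNIV. ?x p * ?y q * ?z r * (?h q r d * ?h p d w))"
      by (simp only: sum_distrib_left[symmetric] assoc)
    also have "\<dots> = (\<Sum>p\<in>UNIV. \<Sum>r\<in>UNIV. \<Sum>q\<in>UNIV. \<Sum>d\<in>UNIV. ?x p * ?y q * ?z r * (?h q r d * ?h p d w))"
      by (rule sum.swap)
    also have "\<dots> = (\<Sum>p\<in>UNIV. \<Sum>q\<in>UNIV. \<Sum>r\<in>UNIV. \<Sum>d\<in>UNIV. ?x p * ?y q * ?z r * (?h q r d * ?h p d w))"
      by (rule sum.cong[OF refl], rule sum.swap)
    also have "\<dots> = (\<Sum>p\<in>UNIV. \<Sum>d\<in>UNIV. \<Sum>q\<in>UNIV. \<Sum>r\<in>UNIV. ?x p * ?y q * ?z r * (?h q r d * ?h p d w))"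
      by (rule sum.cong[OF refl])
        (rule trans[OF sum.cong[OF refl sum.swap] sum.swap])
    also have "\<dots> = tensor_coeff (x * (y * z)) w"
      by (simp add: times_hecke_tensor_def sum_distrib_left sum_distrib_right mult_ac)
    finally show "tensor_coeff (x * y * z) w = tensor_coeff (x * (y * z)) w" .
  qed
qed

end

interpretation hecke_tensor: unital_algebra tensor_scale
proof
  fix a b :: laurent and x y :: "'k::finite hecke_tensor"
  show "tensor_scale a (x + y) = tensor_scale a x + tensor_scale a y"
    by (simp add: tensor_coeff_defs distrib_left)
  show "tensor_scale (a + b) x = tensor_scale a x + tensor_scale b x"
    by (simp add: tensor_coeff_defs distrib_right)
  show "tensor_scale a (tensor_scale b x) = tensor_scale (a * b) x"
    by (simp add: tensor_coeff_defs mult.assoc)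
  show "tensor_scale 1 x = x"
    by (rule tensor_eqI) (simp add: tensor_coeff_defs)
  show "tensor_scale a x * y = tensor_scale a (x * y)"
    by (simp add: tensor_coeff_defs sum_distrib_left mult.assoc)
  show "x * tensor_scale a y = tensor_scale a (x * y)"
    by (simp add: tensor_coeff_defs sum_distrib_left mult_ac)
qed

theorem tensor_mult: "tensor x * tensor y = tensor (\<lambda>i. x i * y i)"
proof (rule tensor_eqI)
  fix w
  have "tensor_coeff (tensor (\<lambda>i. x i * y i)) w =
      (\<Sum>p\<in>UNIV. \<Prod>i\<in>UNIV. \<Sum>b\<in>UNIV.
        hecke_coeff (x i) (p i) * hecke_coeff (y i) b * struct_const (p i) b (w i))"
    by (simp add: tensor_def hecke_coeff_mult prod_sum_UNIV)
  also have "\<dots> = tensor_coeff (tensor x * tensor y) w"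
    by (simp add: tensor_def times_hecke_tensor_def prod_sum_UNIV prod.distrib)
  finally show "tensor_coeff (tensor x * tensor y) w = tensor_coeff (tensor (\<lambda>i. x i * y i)) w" ..
qed

theorem tensor_add:
  "tensor (x(i := y + z)) = tensor (x(i := y)) + tensor (x(i := z))"
  by (rule tensor_eqI)
    (simp add: tensor_def plus_hecke_tensor_def plus_hecke3_def prod.remove[of UNIV i] distrib_right)

theorem tensor_scale_component:
  "tensor (x(i := hecke_scale c y)) = tensor_scale c (tensor (x(i := y)))"
  by (rule tensor_eqI)
    (simp add: tensor_def tensor_scale_def hecke_scale_def prod.remove[of UNIV i] mult.assoc)

lemma tensor_coeff_sum: "tensor_coeff (sum f A) w = (\<Sum>a\<in>A. tensor_coeff (f a) w)"
  by (induction A rule: infinite_finite_induct)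
    (simp_all add: zero_hecke_tensor_def plus_hecke_tensor_def)

theorem tensor_basis:
  "(\<Sum>w\<in>UNIV. tensor_scale (tensor_coeff x w) (tensor (\<lambda>i. T (w i)))) = x"
  "tensor_coeff (\<Sum>w\<in>UNIV. tensor_scale (f w) (tensor (\<lambda>i. T (w i)))) w = f w"
proof -
  show *: "tensor_coeff (\<Sum>w\<in>UNIV. tensor_scale (f w) (tensor (\<lambda>i. T (w i)))) w = f w" for f w
    by (simp add: tensor_coeff_sum tensor_scale_def tensor_def T_def prod_delta
        if_distrib[of "\<lambda>a. _ * a"] cong: if_cong)
  show "(\<Sum>w\<in>UNIV. tensor_scale (tensor_coeff x w) (tensor (\<lambda>i. T (w i)))) = x"
    by (rule tensor_eqI) (simp add: *)
qed


section \<open>The nonstandard Hecke algebra\<close>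

datatype sign = Plus | Minus

fun C_sign :: "simple_refl \<Rightarrow> sign \<Rightarrow> hecke3" where
  "C_sign s Plus = T (refl_perm s) + hecke_scale u_inv 1"
| "C_sign s Minus = T (refl_perm s) - hecke_scale u 1"

instance sign :: finite
proof
  have "(UNIV :: sign set) = {Plus, Minus}"
    using sign.exhaust by blast
  then show "finite (UNIV :: sign set)"
    by (metis finite.emptyI finite.insertI)
qed

definition nonstd_gen :: "simple_refl \<Rightarrow> 'k::finite hecke_tensor" where
  "nonstd_gen s = (\<Sum>a | even (card {i. a i = Minus}). tensor (\<lambda>i. C_sign s (a i)))"

definition nonstd_hecke :: "'k::finite hecke_tensor set" where
  "nonstd_hecke = hecke_tensor.generated_subalgebra (range nonstd_gen)"


section \<open>Chebyshev polynomials and the nonstandard braid relation\<close>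

definition chebyshev :: "nat \<Rightarrow> int poly" where
  "chebyshev n = (THE p. \<forall>\<theta>::real. poly (map_poly of_int p) (cos \<theta>) = cos (real n * \<theta>))"

lemma chebyshev_unique:
  assumes "\<And>\<theta>::real. poly (map_poly of_int p) (cos \<theta>) = poly (map_poly of_int q) (cos \<theta>)"
  shows "p = q"
proof -
  let ?r = "map_poly real_of_int p - map_poly real_of_int q"
  have "x \<in> {x. poly ?r x = 0}" if "x \<in> {-1..1}" for x
    using assms[of "arccos x"] that by (simp add: cos_arccos)
  then have "infinite {x. poly ?r x = 0}"
    using infinite_Icc[of "-1" "1::real"] finite_subset by (metis neg_less_pos subsetI zero_less_one)
  then have "?r = 0"
    using poly_roots_finite by blast
  then have "coeff (map_poly real_of_int p) n = coeff (map_poly real_of_int q) n" for n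
    by simp
  then show ?thesis
    by (intro poly_eqI) (simp add: coeff_map_poly)
qed

lemma chebyshev_eqI:
  assumes "\<And>\<theta>::real. poly (map_poly of_int p) (cos \<theta>) = cos (real n * \<theta>)"
  shows "chebyshev n = p"
  unfolding chebyshev_def
  by (rule the_equality) (use assms in \<open>auto intro: chebyshev_unique\<close>)

lemma chebyshev_0: "chebyshev 0 = 1"
  by (rule chebyshev_eqI) simp

lemma chebyshev_1: "chebyshev 1 = [:0, 1:]"
  by (rule chebyshev_eqI) (simp add: map_poly_pCons)

lemma poly_of_int_rec:
  "poly (map_poly of_int (smult 2 (pCons 0 p) - q)) x =
    2 * x * poly (map_poly of_int p) x - poly (map_poly of_int q) (x :: 'a::comm_ring_1)"
proof -
  have "map_poly of_int (smult 2 (pCons 0 p) - q) =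
      smult 2 (pCons 0 (map_poly of_int p)) - (map_poly of_int q :: 'a poly)"
    by (rule poly_eqI) (auto simp: coeff_map_poly coeff_pCons split: nat.splits)
  then show ?thesis by simp
qed

theorem chebyshev_cos: "poly (map_poly of_int (chebyshev n)) (cos \<theta>) = cos (real n * \<theta>)"
  and chebyshev_rec:
    "chebyshev (Suc (Suc n)) = smult 2 (pCons 0 (chebyshev (Suc n))) - chebyshev n"
proof -
  have cos_rec: "cos (real (Suc (Suc n)) * \<theta>) =
      2 * cos \<theta> * cos (real (Suc n) * \<theta>) - cos (real n * \<theta>)" for n and \<theta> :: real
  proof -
    have "cos (real (Suc (Suc n)) * \<theta>) = cos (real (Suc n) * \<theta> + \<theta>)"
      "cos (real n * \<theta>) = cos (real (Suc n) * \<theta> - \<theta>)"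
      by (simp_all add: algebra_simps)
    then show ?thesis
      by (simp only: cos_add cos_diff) simp
  qed
  have step: "poly (map_poly of_int (smult 2 (pCons 0 q) - p)) (cos \<theta>) = cos (real (Suc (Suc n)) * \<theta>)"
    if "\<And>\<theta>::real. poly (map_poly of_int p) (cos \<theta>) = cos (real n * \<theta>)"
      and "\<And>\<theta>::real. poly (map_poly of_int q) (cos \<theta>) = cos (real (Suc n) * \<theta>)"
    for p q n and \<theta> :: real
    unfolding poly_of_int_rec that cos_rec ..
  have "(\<forall>\<theta>::real. poly (map_poly of_int (chebyshev n)) (cos \<theta>) = cos (real n * \<theta>)) \<and>
    (\<forall>\<theta>::real. poly (map_poly of_int (chebyshev (Suc n))) (cos \<theta>) = cos (real (Suc n) * \<theta>))" for n
  proof (induction n)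
    case 0
    show ?case
      using chebyshev_1 by (simp add: chebyshev_0 map_poly_pCons)
  next
    case (Suc n)
    then have "chebyshev (Suc (Suc n)) = smult 2 (pCons 0 (chebyshev (Suc n))) - chebyshev n"
      by (intro chebyshev_eqI step) simp_all
    with Suc step show ?case by simp
  qed
  note all = this
  show "poly (map_poly of_int (chebyshev n)) (cos \<theta>) = cos (real n * \<theta>)"
    using all by blast
  show "chebyshev (Suc (Suc n)) = smult 2 (pCons 0 (chebyshev (Suc n))) - chebyshev n"
    using all by (intro chebyshev_eqI step) blast+
qed

text \<open>
  The value \<open>T\<^sub>j(1/[2])\<close> lies in the field of fractions of the Laurent polynomials;
  \<open>cheb_coeff k j\<close> is the Laurent polynomial \<open>[2]\<^sup>k T\<^sub>j(1/[2])\<close>, which exists for \<open>j \<le> k\<close>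
  (theorem \<open>Fract_cheb_coeff\<close>).
\<close>

definition cheb_value :: "nat \<Rightarrow> laurent fract" where
  "cheb_value j = poly (map_poly of_int (chebyshev j)) (1 / Fract two_q 1)"

definition cheb_coeff :: "nat \<Rightarrow> nat \<Rightarrow> laurent" where
  "cheb_coeff k j = (THE c. Fract c 1 = Fract two_q 1 ^ k * cheb_value j)"

lemma two_q_neq_0: "two_q \<noteq> 0"
proof -
  have "Poly_Mapping.lookup two_q 1 \<noteq> 0"
    by (simp add: two_q_def u_def u_inv_def lookup_add lookup_single)
  then show ?thesis by auto
qed

theorem Fract_cheb_coeff:
  assumes "j \<le> k"
  shows "Fract (cheb_coeff k j) 1 = Fract two_q 1 ^ k * cheb_value j"
proof -
  let ?b = "Fract two_q 1"
  have b: "?b \<noteq> 0"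
    using two_q_neq_0 by (simp add: Zero_fract_def eq_fract)
  have mult: "\<exists>c. Fract c 1 = x * y"
    if "\<exists>c. Fract c 1 = x" "\<exists>c. Fract c 1 = y" for x y :: "laurent fract"
  proof -
    from that obtain c d where "Fract c 1 = x" "Fract d 1 = y" by blast
    then have "Fract (c * d) 1 = x * y" by auto
    then show ?thesis ..
  qed
  have diff: "\<exists>c. Fract c 1 = x - y"
    if "\<exists>c. Fract c 1 = x" "\<exists>c. Fract c 1 = y" for x y :: "laurent fract"
  proof -
    from that obtain c d where "Fract c 1 = x" "Fract d 1 = y" by blast
    then have "Fract (c - d) 1 = x - y" by auto
    then show ?thesis ..
  qed
  have pow: "\<exists>c. Fract c 1 = ?b ^ n" for n
    by (induction n) (auto simp: One_fract_def intro!: mult)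
  have "\<exists>c. Fract c 1 = (2 :: laurent fract)"
    using Fract_of_nat_eq[of 2] by auto
  note two = this
  have "(\<exists>c. Fract c 1 = ?b ^ j * cheb_value j) \<and>
      (\<exists>c. Fract c 1 = ?b ^ Suc j * cheb_value (Suc j))" for j
  proof (induction j)
    case 0
    show ?case
      using pow[of 0] chebyshev_1 b by (auto simp: cheb_value_def chebyshev_0 map_poly_pCons)
  next
    case (Suc j)
    have "cheb_value (Suc (Suc j)) = 2 * (1 / ?b) * cheb_value (Suc j) - cheb_value j"
      unfolding cheb_value_def chebyshev_rec poly_of_int_rec ..
    moreover have "b ^ Suc (Suc j) * (2 * (1 / b) * x - y) = 2 * (b ^ Suc j * x) - b\<^sup>2 * (b ^ j * y)"
      if "b \<noteq> 0" for b x y :: "laurent fract"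
      using that by (simp add: field_simps power2_eq_square)
    ultimately have "?b ^ Suc (Suc j) * cheb_value (Suc (Suc j)) =
        2 * (?b ^ Suc j * cheb_value (Suc j)) - ?b ^ 2 * (?b ^ j * cheb_value j)"
      using b by simp
    moreover have "\<exists>c. Fract c 1 =
        2 * (?b ^ Suc j * cheb_value (Suc j)) - ?b ^ 2 * (?b ^ j * cheb_value j)"
      using diff[OF mult[OF two] mult[OF pow]] Suc.IH by blast
    ultimately show ?case
      using Suc.IH by simp
  qed
  then have "\<exists>c. Fract c 1 = ?b ^ (k - j) * (?b ^ j * cheb_value j)"
    using mult[OF pow] by blast
  moreover have "?b ^ (k - j) * (?b ^ j * cheb_value j) = ?b ^ k * cheb_value j"
    unfolding mult.assoc[symmetric] power_add[symmetric] using assms by simp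
  ultimately obtain c where c: "Fract c 1 = ?b ^ k * cheb_value j"
    by metis
  have inj: "Fract c 1 = Fract d 1 \<longleftrightarrow> c = d" for c d :: laurent
    by (simp add: eq_fract)
  have "cheb_coeff k j = c"
    unfolding cheb_coeff_def c[symmetric] inj by (rule the_eq_trivial)
  with c show ?thesis by simp
qed

definition braid_poly :: "nat \<Rightarrow> laurent poly" where
  "braid_poly k = (\<Prod>j=1..k. [:- ((cheb_coeff k j)\<^sup>2), 1:])"

end

theory Submission
  imports Defs
begin

text \<open>
  The elements \<open>\<tau>\<^sub>s = C'\<^sub>s + C\<^sub>s\<close> satisfy \<open>\<tau>\<^sub>s\<^sup>2 = [2]\<^sup>2\<close>, and twice a generator \<open>P\<^sub>s\<close> is \<open>[2]\<^sup>k\<close> plus the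
  \<open>k\<close>-th tensor power of \<open>\<tau>\<^sub>s\<close>.  So, after specializing \<open>u\<close> to a complex number and dividing by powers
  of \<open>[2]\<close>, everything happens in the group algebra of the infinite dihedral group generated by the two
  reflections.  In the Hecke algebra their product has the eigenvalues \<open>1\<close>, \<open>v\<^sup>2\<close>, \<open>v\<^sup>-\<^sup>2\<close>
  with \<open>(v + 1/v)/2 = 1/[2]\<close>; the matrix entries of the corresponding two-dimensional dihedral
  representations span the dual of the six-dimensional Hecke algebra.  As these matrices are monomial, a
  tensor product of such matrix entries is an entry of the dihedral representation whose rotation eigenvalue is
  the product of the given ones, hence of the form \<open>v\<^sup>2\<^sup>j\<close> with \<open>\<bar>j\<bar> \<le> k\<close>.  Therefore an element of the free
  algebra evaluates to zero in the tensor power iff it vanishes in these representations, for infinitely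
  many specializations.

  On the representation for \<open>j\<close>, \<open>P\<^sub>1 P\<^sub>2 P\<^sub>1\<close> acts as \<open>([2]\<^sup>k T\<^sub>j(1/[2]))\<^sup>2 P\<^sub>1\<close>, which gives the braid relation.
  Conversely, modulo the quadratic relations each element is
  \<open>\<alpha> + P\<^sub>1 p(P\<^sub>2P\<^sub>1) + P\<^sub>2 q(P\<^sub>1P\<^sub>2) + P\<^sub>1P\<^sub>2 r(P\<^sub>1P\<^sub>2) + P\<^sub>2P\<^sub>1 s(P\<^sub>2P\<^sub>1)\<close>
  with polynomials \<open>p\<close>, \<open>q\<close>, \<open>r\<close>, \<open>s\<close>.  If it vanishes in the irreducible
  representations \<open>1 \<le> j \<le> k\<close>, then \<open>F\<^sub>k\<close> divides \<open>p\<close>, \<open>q\<close>, \<open>r\<close>, \<open>s\<close>, so that, \<open>P\<^sub>1 F\<^sub>k(P\<^sub>2P\<^sub>1)\<close> being an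
  eigenvector of both generators modulo the relations, the element is congruent to \<open>\<alpha>\<close> plus a scalar multiple
  of \<open>P\<^sub>1 F\<^sub>k(P\<^sub>2P\<^sub>1)\<close>; the case \<open>j = 0\<close> shows that \<open>\<alpha>\<close> and this scalar are zero.
\<close>

section \<open>Polynomial evaluation and two-sided ideals\<close>

context unital_algebra
begin

text \<open>Padding with zero coefficients gives polynomials of different degrees a common summation
  range.\<close>

lemma poly_eval_superset:
  assumes "degree p \<le> n"
  shows "poly_eval p x = (\<Sum>i\<le>n. scale (coeff p i) (x ^ i))"
  unfolding poly_eval_def
  by (rule sum.mono_neutral_left) (use assms in \<open>auto simp: coeff_eq_0\<close>)

lemma poly_eval_0 [simp]: "poly_eval 0 x = 0"
  by (simp add: poly_eval_def)

lemma poly_eval_pCons [simp]: "poly_eval (pCons a p) x = scale a 1 + x * poly_eval p x"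
  by (simp add: poly_eval_superset[of "pCons a p" "Suc (degree p)"] degree_pCons_le sum.atMost_Suc_shift
      poly_eval_def sum_distrib_left scale_mult_right del: sum.atMost_Suc)

lemma poly_eval_add [simp]: "poly_eval (p + q) x = poly_eval p x + poly_eval q x"
proof -
  let ?n = "max (degree p) (degree q)"
  show ?thesis
    using degree_add_le_max[of p q]
    by (simp add: poly_eval_superset[where n = ?n] scale_left_distrib sum.distrib)
qed

lemma poly_eval_smult [simp]: "poly_eval (smult c p) x = scale c (poly_eval p x)"
  by (simp add: poly_eval_superset[of _ "degree p"] degree_smult_le scale_sum_right)

lemma poly_eval_mult: "poly_eval (p * q) x = poly_eval p x * poly_eval q x"
  by (induction p) (simp_all add: distrib_right scale_mult_left mult.assoc)

lemma poly_eval_commute: "poly_eval p x * x = x * poly_eval p x"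
  by (induction p) (simp_all add: distrib_left distrib_right scale_mult_left scale_mult_right mult.assoc)

end

context unital_algebra
begin

lemma free_eval_poly_eval:
  "free_eval P (free_algebra.poly_eval q x) = poly_eval q (free_eval P x)"
  by (induction q)
    (simp_all add: free_eval_zero free_eval_add free_eval_mult free_eval_scale free_eval_one)

lemma free_eval_diff: "free_eval P (p - q) = free_eval P p - free_eval P q"
  using free_eval_add[of P "p - q" q] by (simp add: algebra_simps)

lemma range_free_eval: "range (free_eval P) = generated_subalgebra (range P)"
proof
  have word: "prod_list (map P ws) \<in> generated_subalgebra (range P)" for ws
    by (induction ws) (auto intro: generated_subalgebra.intros)
  have "free_eval P p \<in> generated_subalgebra (range P)" for p
    by (induction p rule: free_algebra_induct)
      (auto simp: free_eval_single free_eval_add intro: generated_subalgebra.intros word)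
  then show "range (free_eval P) \<subseteq> generated_subalgebra (range P)"
    by blast
  show "generated_subalgebra (range P) \<subseteq> range (free_eval P)"
  proof
    fix x assume "x \<in> generated_subalgebra (range P)"
    then show "x \<in> range (free_eval P)"
    proof induction
      case one
      show ?case using free_eval_one[of P] by (metis rangeI)
    next
      case (base x)
      then show ?case using free_eval_var[of P] by (metis imageE rangeI)
    next
      case (add x y)
      then show ?case by (auto simp flip: free_eval_add)
    next
      case (mult x y)
      then show ?case by (auto simp flip: free_eval_mult)
    next
      case (scale x c)
      then show ?case by (auto simp flip: free_eval_scale)
    qed
  qed
qed

lemma two_sided_ideal_scale:
  "x \<in> two_sided_ideal R \<Longrightarrow> scale c x \<in> two_sided_ideal R"
  using two_sided_ideal.left[of x R "scale c 1"] by (simp add: scale_mult_left)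

lemma free_eval_two_sided_ideal:
  assumes "x \<in> two_sided_ideal R" and "\<And>r. r \<in> R \<Longrightarrow> free_eval P r = 0"
  shows "free_eval P x = 0"
  using assms(1)
  by induction (simp_all add: assms(2) free_eval_zero free_eval_add free_eval_mult)

text \<open>Iterating the eigenvector equation for right multiplication by \<open>y\<close> turns
  each power of \<open>y\<close> into a scalar. In the matrix representations this makes the
  polynomials of normal forms into numbers.\<close>

lemma eigen_poly_eval:
  assumes "a * y = scale c a"
  shows "a * poly_eval p y = scale (poly p c) a"
proof (induction p)
  case (pCons d p)
  have "a * poly_eval (pCons d p) y = scale d a + (a * y) * poly_eval p y"
    by (simp add: distrib_left scale_mult_right mult.assoc)
  then show ?case
    by (simp add: assms scale_mult_left pCons.IH scale_left_distrib)
qed simp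

end

lemma two_sided_ideal_uminus: "x \<in> two_sided_ideal R \<Longrightarrow> - x \<in> two_sided_ideal R"
  using two_sided_ideal.left[of x R "- 1"] by simp

text \<open>Phrased as a relation so that congruences modulo the ideal can be chained with
  equalities.\<close>

definition ideal_cong :: "'a::ring_1 set \<Rightarrow> 'a \<Rightarrow> 'a \<Rightarrow> bool" where
  "ideal_cong R x y \<longleftrightarrow> x - y \<in> two_sided_ideal R"

lemma ideal_cong_refl [simp]: "ideal_cong R x x"
  by (simp add: ideal_cong_def two_sided_ideal.zero)

lemma ideal_cong_sym: "ideal_cong R x y \<Longrightarrow> ideal_cong R y x"
  using two_sided_ideal_uminus[of "x - y"] by (simp add: ideal_cong_def)

lemma ideal_cong_trans [trans]: "ideal_cong R x y \<Longrightarrow> ideal_cong R y z \<Longrightarrow> ideal_cong R x z"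
  using two_sided_ideal.add[of "x - y" R "y - z"] by (simp add: ideal_cong_def)

lemma ideal_cong_eq_trans [trans]:
  "x = y \<Longrightarrow> ideal_cong R y z \<Longrightarrow> ideal_cong R x z"
  "ideal_cong R x y \<Longrightarrow> y = z \<Longrightarrow> ideal_cong R x z"
  by simp_all

lemma ideal_cong_add: "ideal_cong R x x' \<Longrightarrow> ideal_cong R y y' \<Longrightarrow> ideal_cong R (x + y) (x' + y')"
  using two_sided_ideal.add[of "x - x'" R "y - y'"] by (simp add: ideal_cong_def algebra_simps)

lemma ideal_cong_left: "ideal_cong R x y \<Longrightarrow> ideal_cong R (a * x) (a * y)"
  using two_sided_ideal.left[of "x - y" R a] by (simp add: ideal_cong_def algebra_simps)

lemma ideal_cong_right: "ideal_cong R x y \<Longrightarrow> ideal_cong R (x * a) (y * a)"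
  using two_sided_ideal.right[of "x - y" R a] by (simp add: ideal_cong_def algebra_simps)

context unital_algebra
begin

lemma ideal_cong_scale: "ideal_cong R x y \<Longrightarrow> ideal_cong R (scale c x) (scale c y)"
  using two_sided_ideal_scale[of "x - y" R c] by (simp add: ideal_cong_def scale_right_diff_distrib)

lemma eigen_poly_eval_cong:
  assumes "ideal_cong R (a * y) (scale c a)"
  shows "ideal_cong R (a * poly_eval p y) (scale (poly p c) a)"
proof (induction p)
  case (pCons d p)
  have "a * poly_eval (pCons d p) y = scale d a + (a * y) * poly_eval p y"
    by (simp add: distrib_left scale_mult_right mult.assoc)
  also have "ideal_cong R \<dots> (scale d a + scale c a * poly_eval p y)"
    by (intro ideal_cong_add ideal_cong_refl ideal_cong_right assms)
  also have "scale d a + scale c a * poly_eval p y = scale d a + scale c (a * poly_eval p y)"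
    by (simp add: scale_mult_left)
  also have "ideal_cong R \<dots> (scale d a + scale c (scale (poly p c) a))"
    by (intro ideal_cong_add ideal_cong_refl ideal_cong_scale pCons.IH)
  also have "\<dots> = scale (poly (pCons d p) c) a"
    by (simp add: scale_left_distrib)
  finally show ?case .
qed simp

end

section \<open>Normal forms modulo the relations\<close>

text \<open>Arbitrary \<beta> and \<open>F\<close> stand for the power of [2] and the product over
  Chebyshev values, so that the normal form computations are independent of these.\<close>

definition nonstd_relations :: "'r::comm_ring_1 \<Rightarrow> 'r poly \<Rightarrow> (simple_refl, 'r) free_algebra set" where
  "nonstd_relations \<beta> F =
    {free_var s * free_var s - free_scale \<beta> (free_var s) | s. True} \<union>
    {free_var s1 * free_algebra.poly_eval F (free_var s2 * free_var s1) -
     free_var s2 * free_algebra.poly_eval F (free_var s1 * free_var s2)}"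

text \<open>A general combination of alternating words, sorted by first and last letter:
  \<open>P\<close> for s1...s1, \<open>Q\<close> for s2...s2, \<open>R\<close> for s1...s2,
  \<open>S\<close> for s2...s1, and \<alpha> for the empty word.\<close>

definition alternating_form ::
  "'r::comm_ring_1 \<Rightarrow> 'r poly \<Rightarrow> 'r poly \<Rightarrow> 'r poly \<Rightarrow> 'r poly \<Rightarrow> (simple_refl, 'r) free_algebra" where
  "alternating_form \<alpha> P Q R S = free_scale \<alpha> 1
    + free_var s1 * free_algebra.poly_eval P (free_var s2 * free_var s1)
    + free_var s2 * free_algebra.poly_eval Q (free_var s1 * free_var s2)
    + free_var s1 * free_var s2 * free_algebra.poly_eval R (free_var s1 * free_var s2)
    + free_var s2 * free_var s1 * free_algebra.poly_eval S (free_var s2 * free_var s1)"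

lemma quadratic_cong:
  "ideal_cong (nonstd_relations \<beta> F) (free_var s * free_var s) (free_scale \<beta> (free_var s))"
  unfolding ideal_cong_def nonstd_relations_def by (intro two_sided_ideal.base) blast

lemma quadratic_cong':
  "ideal_cong (nonstd_relations \<beta> F) (free_var s * (free_var s * a)) (free_scale \<beta> (free_var s * a))"
  using ideal_cong_right[OF quadratic_cong, of \<beta> F s a] by (simp add: mult.assoc free_algebra.scale_mult_left)

lemma braid_cong:
  "ideal_cong (nonstd_relations \<beta> F)
    (free_var s1 * free_algebra.poly_eval F (free_var s2 * free_var s1))
    (free_var s2 * free_algebra.poly_eval F (free_var s1 * free_var s2))"
  unfolding ideal_cong_def nonstd_relations_def by (intro two_sided_ideal.base) blast

text \<open>A word starting with \<open>s1\<close> only acquires the factor \<beta>; one starting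
  with \<open>s2\<close> becomes a longer alternating word. \<open>pCons 0\<close> accounts for the
  additional factor s2 s1.\<close>

lemma s1_alternating_form:
  "ideal_cong (nonstd_relations \<beta> F) (free_var s1 * alternating_form \<alpha> P Q R S)
    (alternating_form 0 ([:\<alpha>:] + smult \<beta> P + pCons 0 S) 0 (Q + smult \<beta> R) 0)"
proof -
  let ?X1 = "free_var s1" and ?X2 = "free_var s2"
  let ?e = "free_algebra.poly_eval"
  have "?X1 * alternating_form \<alpha> P Q R S =
      free_scale \<alpha> ?X1 + ?X1 * (?X1 * ?e P (?X2 * ?X1)) + ?X1 * ?X2 * ?e Q (?X1 * ?X2)
      + ?X1 * (?X1 * (?X2 * ?e R (?X1 * ?X2))) + ?X1 * (?X2 * ?X1 * ?e S (?X2 * ?X1))"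
    by (simp add: alternating_form_def distrib_left mult.assoc free_algebra.scale_mult_right)
  also have "ideal_cong (nonstd_relations \<beta> F) \<dots>
      (free_scale \<alpha> ?X1 + free_scale \<beta> (?X1 * ?e P (?X2 * ?X1)) + ?X1 * ?X2 * ?e Q (?X1 * ?X2)
      + free_scale \<beta> (?X1 * (?X2 * ?e R (?X1 * ?X2))) + ?X1 * (?X2 * ?X1 * ?e S (?X2 * ?X1)))"
    by (intro ideal_cong_add ideal_cong_refl quadratic_cong')
  also have "\<dots> = alternating_form 0 ([:\<alpha>:] + smult \<beta> P + pCons 0 S) 0 (Q + smult \<beta> R) 0"
    by (simp add: alternating_form_def distrib_left mult.assoc free_algebra.scale_mult_right)
  finally show ?thesis .
qed

lemma s2_alternating_form:
  "ideal_cong (nonstd_relations \<beta> F) (free_var s2 * alternating_form \<alpha> P Q R S)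
    (alternating_form 0 0 ([:\<alpha>:] + smult \<beta> Q + pCons 0 R) 0 (P + smult \<beta> S))"
proof -
  let ?X1 = "free_var s1" and ?X2 = "free_var s2"
  let ?e = "free_algebra.poly_eval"
  have "?X2 * alternating_form \<alpha> P Q R S =
      free_scale \<alpha> ?X2 + ?X2 * ?X1 * ?e P (?X2 * ?X1) + ?X2 * (?X2 * ?e Q (?X1 * ?X2))
      + ?X2 * (?X1 * ?X2 * ?e R (?X1 * ?X2)) + ?X2 * (?X2 * (?X1 * ?e S (?X2 * ?X1)))"
    by (simp add: alternating_form_def distrib_left mult.assoc free_algebra.scale_mult_right)
  also have "ideal_cong (nonstd_relations \<beta> F) \<dots>
      (free_scale \<alpha> ?X2 + ?X2 * ?X1 * ?e P (?X2 * ?X1) + free_scale \<beta> (?X2 * ?e Q (?X1 * ?X2))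
      + ?X2 * (?X1 * ?X2 * ?e R (?X1 * ?X2)) + free_scale \<beta> (?X2 * (?X1 * ?e S (?X2 * ?X1))))"
    by (intro ideal_cong_add ideal_cong_refl quadratic_cong')
  also have "\<dots> = alternating_form 0 0 ([:\<alpha>:] + smult \<beta> Q + pCons 0 R) 0 (P + smult \<beta> S)"
    by (simp add: alternating_form_def distrib_left mult.assoc free_algebra.scale_mult_right)
  finally show ?thesis .
qed

lemma alternating_form_add:
  "alternating_form \<alpha> P Q R S + alternating_form \<alpha>' P' Q' R' S' =
    alternating_form (\<alpha> + \<alpha>') (P + P') (Q + Q') (R + R') (S + S')"
  by (simp add: alternating_form_def distrib_left free_algebra.scale_left_distrib)

text \<open>Alternating forms are stable under left multiplication by each generator, so words are
  normalized letter by letter from the right.\<close>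

lemma ex_alternating_form:
  "\<exists>\<alpha> P Q R S. ideal_cong (nonstd_relations \<beta> F) p (alternating_form \<alpha> P Q R S)"
proof (induction p rule: free_algebra_induct)
  case (single w c)
  have "\<exists>\<alpha> P Q R S. ideal_cong (nonstd_relations \<beta> F)
      (Poly_Mapping.single (Word ws) c) (alternating_form \<alpha> P Q R S)" for ws
  proof (induction ws)
    case Nil
    have "Poly_Mapping.single (Word []) c = alternating_form c 0 0 0 0"
      by (simp add: alternating_form_def free_scale_def zero_free_monoid_def)
    then show ?case by (metis ideal_cong_refl)
  next
    case (Cons s ws)
    then obtain \<alpha> P Q R S where "ideal_cong (nonstd_relations \<beta> F)
        (Poly_Mapping.single (Word ws) c) (alternating_form \<alpha> P Q R S)"
      by blast
    from ideal_cong_left[OF this, of "free_var s"]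
    have *: "ideal_cong (nonstd_relations \<beta> F) (Poly_Mapping.single (Word (s # ws)) c)
        (free_var s * alternating_form \<alpha> P Q R S)"
      by (simp add: free_var_def mult_single plus_free_monoid_def)
    show ?case
    proof (cases s)
      case s1
      show ?thesis
        using ideal_cong_trans[OF *[unfolded s1] s1_alternating_form] unfolding s1 by blast
    next
      case s2
      show ?thesis
        using ideal_cong_trans[OF *[unfolded s2] s2_alternating_form] unfolding s2 by blast
    qed
  qed
  then show ?case by (cases w) auto
next
  case (add p q)
  then show ?case by (metis ideal_cong_add alternating_form_add)
qed

text \<open>\<open>Z\<close> starts with \<open>X1\<close> and is congruent to \<open>Z'\<close>,
  which starts with \<open>X2\<close>; so the quadratic relations make it an eigenvector of both
  generators.\<close>

lemma braid_eigen:
  fixes \<beta> :: "'r::comm_ring_1" and F :: "'r poly"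
  defines "X1 \<equiv> free_var s1" and "X2 \<equiv> free_var s2"
  defines "Z \<equiv> X1 * free_algebra.poly_eval F (X2 * X1)"
    and "Z' \<equiv> X2 * free_algebra.poly_eval F (X1 * X2)"
  shows "ideal_cong (nonstd_relations \<beta> F) (X1 * Z') (free_scale \<beta> Z)"
    and "ideal_cong (nonstd_relations \<beta> F) (X2 * Z) (free_scale \<beta> Z)"
    and "ideal_cong (nonstd_relations \<beta> F) (Z * (X2 * X1)) (free_scale (\<beta>\<^sup>2) Z)"
    and "ideal_cong (nonstd_relations \<beta> F) (Z' * (X1 * X2)) (free_scale (\<beta>\<^sup>2) Z')"
proof -
  let ?c = "ideal_cong (nonstd_relations \<beta> F)"
  have ZZ': "?c Z Z'"
    unfolding X1_def X2_def Z_def Z'_def by (rule braid_cong)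
  have 1: "?c (X1 * Z) (free_scale \<beta> Z)" "?c (X2 * Z') (free_scale \<beta> Z')"
    unfolding X1_def X2_def Z_def Z'_def by (rule quadratic_cong')+
  show a: "?c (X1 * Z') (free_scale \<beta> Z)"
    using ideal_cong_left[OF ideal_cong_sym[OF ZZ'], of X1] 1(1) by (rule ideal_cong_trans)
  have "?c (X2 * Z) (X2 * Z')"
    by (intro ideal_cong_left ZZ')
  also note 1(2)
  also have "?c (free_scale \<beta> Z') (free_scale \<beta> Z)"
    by (rule free_algebra.ideal_cong_scale[OF ideal_cong_sym[OF ZZ']])
  finally show b: "?c (X2 * Z) (free_scale \<beta> Z)" .
  \<comment> \<open>A polynomial commutes with its argument, which turns right multiplication by
    \<open>X2 * X1\<close> into left multiplication by \<open>X1 * X2\<close>.\<close>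
  have "Z * (X2 * X1) = X1 * (X2 * Z)"
    by (simp add: Z_def mult.assoc free_algebra.poly_eval_commute[of F "X2 * X1", unfolded mult.assoc])
  also have "?c \<dots> (X1 * free_scale \<beta> Z)"
    by (intro ideal_cong_left b)
  also have "X1 * free_scale \<beta> Z = free_scale \<beta> (X1 * Z)"
    by (rule free_algebra.scale_mult_right)
  also have "?c \<dots> (free_scale \<beta> (free_scale \<beta> Z))"
    by (intro free_algebra.ideal_cong_scale 1)
  finally show "?c (Z * (X2 * X1)) (free_scale (\<beta>\<^sup>2) Z)"
    by (simp add: power2_eq_square)
  have "Z' * (X1 * X2) = X2 * (X1 * Z')"
    by (simp add: Z'_def mult.assoc free_algebra.poly_eval_commute[of F "X1 * X2", unfolded mult.assoc])
  also have "?c \<dots> (X2 * free_scale \<beta> Z)"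
    by (intro ideal_cong_left a)
  also have "X2 * free_scale \<beta> Z = free_scale \<beta> (X2 * Z)"
    by (rule free_algebra.scale_mult_right)
  also have "?c \<dots> (free_scale \<beta> (X2 * Z'))"
    by (intro free_algebra.ideal_cong_scale ideal_cong_left ZZ')
  also have "?c \<dots> (free_scale \<beta> (free_scale \<beta> Z'))"
    by (intro free_algebra.ideal_cong_scale 1)
  finally show "?c (Z' * (X1 * X2)) (free_scale (\<beta>\<^sup>2) Z')"
    by (simp add: power2_eq_square)
qed

text \<open>Once \<open>F\<close> is split off, each of the four summands contains \<open>Z\<close>
  or \<open>Z'\<close> and is therefore congruent to a scalar multiple of \<open>Z\<close>. The
  hypothesis \<open>sum\<close> makes the total scalar vanish.\<close>

lemma alternating_form_in_ideal:
  fixes \<beta> :: "'r::idom"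
  assumes dvd: "F dvd P" "F dvd Q" "F dvd R" "F dvd S" and F: "poly F (\<beta>\<^sup>2) \<noteq> 0"
    and sum: "poly (P + Q + smult \<beta> R + smult \<beta> S) (\<beta>\<^sup>2) = 0"
  shows "alternating_form 0 P Q R S \<in> two_sided_ideal (nonstd_relations \<beta> F)"
proof -
  let ?c = "ideal_cong (nonstd_relations \<beta> F)"
  define X1 X2 :: "(simple_refl, 'r) free_algebra" where "X1 = free_var s1" and "X2 = free_var s2"
  let ?e = "free_algebra.poly_eval"
  define Z Z' where "Z = X1 * ?e F (X2 * X1)" and "Z' = X2 * ?e F (X1 * X2)"
  note eigen = braid_eigen[where \<beta> = \<beta> and F = F, folded X1_def X2_def, folded Z_def Z'_def]
  from dvd obtain p q r s where PQRS: "P = F * p" "Q = F * q" "R = F * r" "S = F * s"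
    by (auto elim!: dvdE)
  have ZZ': "?c Z Z'"
    unfolding X1_def X2_def Z_def Z'_def by (rule braid_cong)
  have Z: "?c (Z * ?e f (X2 * X1)) (free_scale (poly f (\<beta>\<^sup>2)) Z)" for f
    by (intro free_algebra.eigen_poly_eval_cong eigen)
  have Z': "?c (Z' * ?e f (X1 * X2)) (free_scale (poly f (\<beta>\<^sup>2)) Z')" for f
    by (intro free_algebra.eigen_poly_eval_cong eigen)
  have q: "?c (Z' * ?e q (X1 * X2)) (free_scale (poly q (\<beta>\<^sup>2)) Z)"
    by (rule ideal_cong_trans[OF Z' free_algebra.ideal_cong_scale[OF ideal_cong_sym[OF ZZ']]])
  have r: "?c (X1 * (Z' * ?e r (X1 * X2))) (free_scale (poly r (\<beta>\<^sup>2)) (free_scale \<beta> Z))"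
    using ideal_cong_trans[OF ideal_cong_left[OF Z', of X1]
        free_algebra.ideal_cong_scale[OF eigen(1), of "poly r (\<beta>\<^sup>2)",
          folded free_algebra.scale_mult_right]] .
  have s: "?c (X2 * (Z * ?e s (X2 * X1))) (free_scale (poly s (\<beta>\<^sup>2)) (free_scale \<beta> Z))"
    using ideal_cong_trans[OF ideal_cong_left[OF Z, of X2]
        free_algebra.ideal_cong_scale[OF eigen(2), of "poly s (\<beta>\<^sup>2)",
          folded free_algebra.scale_mult_right]] .
  have "alternating_form 0 P Q R S = Z * ?e p (X2 * X1) + Z' * ?e q (X1 * X2)
      + X1 * (Z' * ?e r (X1 * X2)) + X2 * (Z * ?e s (X2 * X1))"
    unfolding alternating_form_def PQRS free_algebra.poly_eval_mult Z_def Z'_def X1_def X2_def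
    by (simp add: mult.assoc)
  also have "?c \<dots>
      (free_scale (poly p (\<beta>\<^sup>2)) Z + free_scale (poly q (\<beta>\<^sup>2)) Z
       + free_scale (poly r (\<beta>\<^sup>2)) (free_scale \<beta> Z) + free_scale (poly s (\<beta>\<^sup>2)) (free_scale \<beta> Z))"
    by (intro ideal_cong_add Z q r s)
  also have "free_scale (poly p (\<beta>\<^sup>2)) Z + free_scale (poly q (\<beta>\<^sup>2)) Z
       + free_scale (poly r (\<beta>\<^sup>2)) (free_scale \<beta> Z) + free_scale (poly s (\<beta>\<^sup>2)) (free_scale \<beta> Z)
      = free_scale (poly (p + q + smult \<beta> r + smult \<beta> s) (\<beta>\<^sup>2)) Z"
    by (simp add: free_algebra.scale_left_distrib mult.commute)
  also have "poly (p + q + smult \<beta> r + smult \<beta> s) (\<beta>\<^sup>2) = 0"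
  proof -
    \<comment> \<open>Multiplied by the value of \<open>F\<close>, the scalar becomes the left side
      of \<open>sum\<close>; that value cancels in the domain.\<close>
    have "poly F (\<beta>\<^sup>2) * poly (p + q + smult \<beta> r + smult \<beta> s) (\<beta>\<^sup>2) = 0"
      using sum by (simp add: PQRS algebra_simps)
    with F show ?thesis by simp
  qed
  finally show ?thesis
    by (simp add: ideal_cong_def)
qed

text \<open>The coefficients form only a domain, so the linear factors are split off one at a time.
  As \<open>f b - f a\<close> is nonzero, the remaining roots pass to the quotient.\<close>

lemma prod_linear_dvd:
  fixes p :: "'a::idom poly"
  assumes "finite A" "inj_on f A" "\<And>a. a \<in> A \<Longrightarrow> poly p (f a) = 0"
  shows "(\<Prod>a\<in>A. [:- f a, 1:]) dvd p"
  using assms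
proof (induction A arbitrary: p)
  case (insert a A)
  then obtain q where q: "p = [:- f a, 1:] * q"
    by (metis dvdE insertI1 poly_eq_0_iff_dvd)
  have "poly q (f b) = 0" if "b \<in> A" for b
  proof -
    have "poly p (f b) = 0" "f b \<noteq> f a"
      using insert.prems insert.hyps that by (auto simp: inj_on_def)
    then show ?thesis
      by (simp add: q)
  qed
  with insert have "(\<Prod>b\<in>A. [:- f b, 1:]) dvd q"
    by (metis inj_on_insert)
  then show ?case
    unfolding q by (simp only: prod.insert[OF insert.hyps] mult_dvd_mono dvd_refl)
qed simp

section \<open>Specialization of the parameter\<close>

definition laurent_eval :: "complex \<Rightarrow> laurent \<Rightarrow> complex" where
  "laurent_eval t p = (\<Sum>n\<in>Poly_Mapping.keys p. of_int (Poly_Mapping.lookup p n) * t powi n)"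

lemma laurent_eval_superset:
  assumes "finite A" "Poly_Mapping.keys p \<subseteq> A"
  shows "laurent_eval t p = (\<Sum>n\<in>A. of_int (Poly_Mapping.lookup p n) * t powi n)"
  unfolding laurent_eval_def
  by (rule sum.mono_neutral_left) (use assms in \<open>auto simp: in_keys_iff\<close>)

lemma laurent_eval_single [simp]: "laurent_eval t (Poly_Mapping.single n c) = of_int c * t powi n"
  by (subst laurent_eval_superset[where A = "{n}"]) (auto simp: lookup_single)

lemma laurent_eval_add [simp]: "laurent_eval t (p + q) = laurent_eval t p + laurent_eval t q"
proof -
  let ?A = "Poly_Mapping.keys p \<union> Poly_Mapping.keys q"
  have "Poly_Mapping.keys (p + q) \<subseteq> ?A"
    by (rule Poly_Mapping.keys_add)
  then show ?thesis
    by (simp add: laurent_eval_superset[where A = ?A] lookup_add distrib_right sum.distrib)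
qed

lemma laurent_eval_0 [simp]: "laurent_eval t 0 = 0"
  by (simp add: laurent_eval_def)

lemma laurent_eval_1 [simp]: "laurent_eval t 1 = 1"
  by (simp flip: single_one)

lemma laurent_eval_diff [simp]: "laurent_eval t (p - q) = laurent_eval t p - laurent_eval t q"
  using laurent_eval_add[of t "p - q" q] by (simp add: algebra_simps del: laurent_eval_add)

lemma laurent_induct [case_names single add]:
  fixes p :: laurent
  assumes single: "\<And>n c. Q (Poly_Mapping.single n c)"
    and add: "\<And>p q. Q p \<Longrightarrow> Q q \<Longrightarrow> Q (p + q)"
  shows "Q p"
proof (induction p rule: update_induct)
  case const
  then show ?case using single[of 0 0] by simp
next
  case (update f a b)
  have "Poly_Mapping.update a b f = f + Poly_Mapping.single a b"
    using update.hyps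
    by (intro poly_mapping_eqI) (auto simp: lookup_update lookup_add lookup_single in_keys_iff when_def)
  then show ?case using add[OF update.IH single] by simp
qed

lemma laurent_eval_mult:
  assumes "t \<noteq> 0"
  shows "laurent_eval t (p * q) = laurent_eval t p * laurent_eval t q"
proof (induction p rule: laurent_induct)
  case (single m c)
  show ?case
    by (induction q rule: laurent_induct)
      (use assms in \<open>simp_all add: mult_single power_int_add distrib_left\<close>)
qed (simp add: distrib_right)

text \<open>Multiplication by a power of \<open>t\<close> gives an ordinary polynomial with
  infinitely many roots.\<close>

lemma laurent_eq_0I:
  assumes "infinite A" and A: "\<And>t. t \<in> A \<Longrightarrow> t \<noteq> 0 \<and> laurent_eval t p = 0"
  shows "p = 0"
proof (rule poly_mapping_eqI)
  fix m
  \<comment> \<open>A bound for the negative exponents; the inserted 0 keeps the set nonempty when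
    \<open>p = 0\<close>.\<close>
  define N where "N = Max (insert 0 ((\<lambda>n. nat (- n)) ` Poly_Mapping.keys p))"
  have N: "- int N \<le> n" if "n \<in> Poly_Mapping.keys p" for n
  proof -
    have "nat (- n) \<le> N"
      unfolding N_def using that by (intro Max_ge) auto
    then show ?thesis by linarith
  qed
  define q :: "complex poly" where
    "q = (\<Sum>n\<in>Poly_Mapping.keys p. monom (of_int (Poly_Mapping.lookup p n)) (nat (n + int N)))"
  have "poly q t = t ^ N * laurent_eval t p" if "t \<noteq> 0" for t
    unfolding q_def laurent_eval_def poly_sum sum_distrib_left
  proof (rule sum.cong[OF refl])
    fix n assume "n \<in> Poly_Mapping.keys p"
    then have "t ^ nat (n + int N) = t ^ N * t powi n"
      using N[of n] that power_int_of_nat[of t "nat (n + int N)"] by (simp add: power_int_add mult.commute)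
    then show "poly (monom (of_int (Poly_Mapping.lookup p n)) (nat (n + int N))) t =
        t ^ N * (of_int (Poly_Mapping.lookup p n) * t powi n)"
      by (simp add: poly_monom)
  qed
  with A have "A \<subseteq> {t. poly q t = 0}"
    by auto
  with \<open>infinite A\<close> have q: "q = 0"
    using poly_roots_finite finite_subset by blast
  show "Poly_Mapping.lookup p m = Poly_Mapping.lookup 0 m"
  proof (cases "m \<in> Poly_Mapping.keys p")
    case True
    have "coeff q (nat (m + int N)) =
        (\<Sum>n\<in>Poly_Mapping.keys p. if n = m then of_int (Poly_Mapping.lookup p n) else 0)"
      unfolding q_def coeff_sum
    proof (rule sum.cong[OF refl])
      fix n assume "n \<in> Poly_Mapping.keys p"
      then have "nat (n + int N) = nat (m + int N) \<longleftrightarrow> n = m"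
        using N[of n] N[OF True] by auto
      then show "coeff (monom (of_int (Poly_Mapping.lookup p n)) (nat (n + int N))) (nat (m + int N)) =
          (if n = m then of_int (Poly_Mapping.lookup p n) else (0 :: complex))"
        by simp
    qed
    also have "\<dots> = of_int (Poly_Mapping.lookup p m)"
      using True by simp
    finally show ?thesis
      by (simp add: q)
  qed (simp add: in_keys_iff)
qed

text \<open>
  With \<open>v\<close> playing the role of \<open>exp (i\<theta>)\<close>, the condition \<open>two_q_v\<close> reads \<open>cos \<theta> = 1/[2]\<close>.
\<close>

locale specialization =
  fixes t v :: complex
  assumes t_neq_0: "t \<noteq> 0"
    and two_q_v: "(t + inverse t) * (v + inverse v) = 2"
    and v_power: "0 < n \<Longrightarrow> v ^ n \<noteq> 1"
begin

lemma v_neq_0: "v \<noteq> 0"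
  using two_q_v by auto

lemma eval_mult [simp]: "laurent_eval t (p * q) = laurent_eval t p * laurent_eval t q"
  by (rule laurent_eval_mult[OF t_neq_0])

lemma eval_power [simp]: "laurent_eval t (p ^ n) = laurent_eval t p ^ n"
  by (induction n) simp_all

lemma eval_prod [simp]: "laurent_eval t (prod f A) = (\<Prod>a\<in>A. laurent_eval t (f a))"
  by (induction A rule: infinite_finite_induct) simp_all

lemma eval_u [simp]: "laurent_eval t u = t" "laurent_eval t u_inv = inverse t"
  by (simp_all add: u_def u_inv_def power_int_minus)

lemma eval_two_q [simp]: "laurent_eval t two_q = t + inverse t"
  by (simp add: two_q_def)

lemma eval_two_q_neq_0: "t + inverse t \<noteq> 0"
  using two_q_v by auto

end

text \<open>Each real r > 1 serves as \<open>v\<close>, since it is not a root of unity, and a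
  matching \<open>t\<close> solves a quadratic equation. Distinct r give distinct \<open>t\<close>
  because r + 1/r is injective on r > 1.\<close>

lemma infinite_specializations: "infinite {t. \<exists>v. specialization t v}"
proof -
  have "\<exists>t. t \<noteq> 0 \<and> t + inverse t = 2 / complex_of_real (r + inverse r)" for r
  proof -
    define b where "b = 2 / complex_of_real (r + inverse r)"
    \<comment> \<open>A root of X^2 - b X + 1; the other root \<open>b - t\<close> is then its
      inverse.\<close>
    define t where "t = (b + csqrt (b\<^sup>2 - 4)) / 2"
    have "t * (b - t) = (b\<^sup>2 - (csqrt (b\<^sup>2 - 4))\<^sup>2) / 4"
      unfolding t_def by (simp add: field_simps power2_eq_square)
    then have *: "t * (b - t) = 1"
      by simp
    then have "t \<noteq> 0" by auto
    moreover have "inverse t = b - t"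
      using * by (metis inverse_unique)
    ultimately show ?thesis
      unfolding b_def[symmetric] by auto
  qed
  then obtain f where f: "\<And>r. f r \<noteq> 0" "\<And>r. f r + inverse (f r) = 2 / complex_of_real (r + inverse r)"
    by metis
  have "specialization (f r) (of_real r)" if "r > 1" for r
  proof
    have "r + inverse r \<noteq> 0"
      using that by (smt (verit) positive_imp_inverse_positive)
    then show "(f r + inverse (f r)) * (of_real r + inverse (of_real r)) = 2"
      unfolding f(2) by (simp flip: of_real_inverse of_real_add)
    show "complex_of_real r ^ n \<noteq> 1" if "0 < n" for n
      using one_less_power[OF \<open>r > 1\<close> that] by (simp flip: of_real_power)
  qed (rule f)
  then have "f ` {1<..} \<subseteq> {t. \<exists>v. specialization t v}"
    by auto
  moreover have "inj_on f {1<..}"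
  proof (rule inj_onI)
    fix r s :: real assume rs: "r \<in> {1<..}" "s \<in> {1<..}" and eq: "f r = f s"
    have "r + inverse r \<noteq> 0" "s + inverse s \<noteq> 0"
      using rs by (smt (verit) greaterThan_iff positive_imp_inverse_positive)+
    moreover have "complex_of_real (2 / (r + inverse r)) = complex_of_real (2 / (s + inverse s))"
      using f(2)[of r] f(2)[of s] eq by simp
    ultimately have "r + inverse r = s + inverse s"
      unfolding of_real_eq_iff by (simp add: divide_eq_eq eq_divide_eq)
    then have "(r - s) * (r * s - 1) = 0"
      using rs by (simp add: field_simps)
    moreover have "r * s > 1"
      using rs by (simp add: less_1_mult)
    ultimately show "r = s" by simp
  qed
  ultimately show ?thesis
    using infinite_Ioi[of "1::real"] finite_imageD finite_subset by blast
qed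

text \<open>Identities between Laurent polynomials are thereby reduced to complex specializations,
  where the parameter \<open>v\<close> is available.\<close>

lemma laurent_eq_0_iff_eval: "p = 0 \<longleftrightarrow> (\<forall>t v. specialization t v \<longrightarrow> laurent_eval t p = 0)"
  using laurent_eq_0I[OF infinite_specializations, of p] specialization.t_neq_0 by auto

text \<open>This is [2]^j T_j(1/[2]): the Chebyshev recursion with its denominators cleared.\<close>

fun cheb_num :: "nat \<Rightarrow> laurent" where
  "cheb_num 0 = 1"
| "cheb_num (Suc 0) = 1"
| "cheb_num (Suc (Suc j)) = 2 * cheb_num (Suc j) - two_q\<^sup>2 * cheb_num j"

lemma Fract_cheb_num: "Fract (cheb_num j) 1 = Fract two_q 1 ^ j * cheb_value j"
proof -
  let ?b = "Fract two_q 1"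
  have b: "?b \<noteq> 0"
    using two_q_neq_0 by (simp add: Zero_fract_def eq_fract)
  have two: "(2 :: laurent fract) = Fract 2 1"
    using Fract_of_nat_eq[of 2] by simp
  show ?thesis
  proof (induction j rule: cheb_num.induct)
    case 1
    show ?case
      by (simp add: cheb_value_def chebyshev_0 One_fract_def[symmetric])
  next
    case 2
    show ?case
      using b chebyshev_1 by (simp add: cheb_value_def map_poly_pCons One_fract_def[symmetric])
  next
    case (3 j)
    have "cheb_value (Suc (Suc j)) = 2 * (1 / ?b) * cheb_value (Suc j) - cheb_value j"
      unfolding cheb_value_def chebyshev_rec poly_of_int_rec ..
    moreover have "b ^ Suc (Suc j) * (2 * (1 / b) * x - y) = 2 * (b ^ Suc j * x) - b\<^sup>2 * (b ^ j * y)"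
      if "b \<noteq> 0" for b x y :: "laurent fract"
      using that by (simp add: field_simps power2_eq_square)
    ultimately have "?b ^ Suc (Suc j) * cheb_value (Suc (Suc j)) =
        2 * (?b ^ Suc j * cheb_value (Suc j)) - ?b\<^sup>2 * (?b ^ j * cheb_value j)"
      using b by simp
    also have "\<dots> = Fract 2 1 * Fract (cheb_num (Suc j)) 1 - (Fract two_q 1)\<^sup>2 * Fract (cheb_num j) 1"
      unfolding 3 two ..
    also have "\<dots> = Fract (cheb_num (Suc (Suc j))) 1"
      by (simp add: power2_eq_square)
    finally show ?case ..
  qed
qed

lemma cheb_coeff_eq: "j \<le> k \<Longrightarrow> cheb_coeff k j = two_q ^ (k - j) * cheb_num j"
proof -
  assume "j \<le> k"
  have pow: "Fract (two_q ^ n) 1 = Fract two_q 1 ^ n" for n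
  proof (induction n)
    case (Suc n)
    have "Fract (two_q ^ Suc n) 1 = Fract two_q 1 * Fract (two_q ^ n) 1" by simp
    then show ?case unfolding Suc by simp
  qed (simp add: One_fract_def)
  have "Fract (cheb_coeff k j) 1 = Fract two_q 1 ^ (k - j) * (Fract two_q 1 ^ j * cheb_value j)"
    unfolding Fract_cheb_coeff[OF \<open>j \<le> k\<close>] mult.assoc[symmetric] power_add[symmetric]
    using \<open>j \<le> k\<close> by simp
  also have "\<dots> = Fract (two_q ^ (k - j) * cheb_num j) 1"
    unfolding Fract_cheb_num[symmetric] unfolding pow[symmetric] by simp
  finally show ?thesis
    by (simp add: eq_fract)
qed

section \<open>Chebyshev values in terms of \<open>v\<close>\<close>

context specialization
begin

text \<open>For v = exp(i \<theta>) this is T_j(cos \<theta>) = cos(j \<theta>) with cos \<theta> =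
  1/[2].\<close>

lemma eval_cheb_num:
  "2 * laurent_eval t (cheb_num j) = (t + inverse t) ^ j * (v ^ j + inverse v ^ j)"
proof (induction j rule: cheb_num.induct)
  case 2
  show ?case using two_q_v by simp
next
  case (3 j)
  define b w where "b = t + inverse t" and "w = inverse v"
  have vw: "v * w = 1"
    using v_neq_0 by (simp add: w_def)
  have bvw: "b * (v + w) = 2"
    using two_q_v by (simp add: b_def w_def)
  have two: "laurent_eval t 2 = 2"
    using laurent_eval_add[of t 1 1] by simp
  have "2 * laurent_eval t (cheb_num (Suc (Suc j))) =
      2 * (2 * laurent_eval t (cheb_num (Suc j))) - b\<^sup>2 * (2 * laurent_eval t (cheb_num j))"
    by (simp add: two b_def algebra_simps)
  \<comment> \<open>Writing the leading 2 as \<open>b * (v + w)\<close> makes the recursion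
    homogeneous in \<open>b\<close>.\<close>
  also have "\<dots> = b * (v + w) * (b ^ Suc j * (v ^ Suc j + w ^ Suc j)) - b\<^sup>2 * (b ^ j * (v ^ j + w ^ j))"
    unfolding 3 bvw unfolding b_def w_def by (rule refl)
  also have "\<dots> = b ^ Suc (Suc j) * (v ^ Suc (Suc j) + w ^ Suc (Suc j) + (v * w - 1) * (v ^ j + w ^ j))"
    by (simp add: algebra_simps power2_eq_square)
  also have "\<dots> = b ^ Suc (Suc j) * (v ^ Suc (Suc j) + w ^ Suc (Suc j))"
    by (simp add: vw)
  finally show ?case
    by (simp add: b_def w_def)
qed simp

lemma eval_cheb_coeff:
  assumes "j \<le> k"
  shows "laurent_eval t (cheb_coeff k j) = (t + inverse t) ^ k * (v ^ j + inverse v ^ j) / 2"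
proof -
  have "2 * laurent_eval t (cheb_coeff k j) =
      (t + inverse t) ^ (k - j) * (2 * laurent_eval t (cheb_num j))"
    by (simp add: cheb_coeff_eq[OF assms])
  also have "\<dots> = (t + inverse t) ^ (k - j + j) * (v ^ j + inverse v ^ j)"
    unfolding eval_cheb_num power_add by (simp add: mult.assoc)
  finally show ?thesis
    using assms by (simp add: mult.commute[of _ 2])
qed

lemma v_power_inj: "v ^ m = v ^ n \<Longrightarrow> m = n"
proof (induction m n rule: linorder_wlog)
  case (le m n)
  then have "v ^ m * v ^ (n - m) = v ^ n"
    by (metis le_add_diff_inverse power_add)
  with le(2) have "v ^ m * v ^ (n - m) = v ^ m * 1"
    by simp
  then have "v ^ (n - m) = 1"
    using v_neq_0 by simp
  with v_power[of "n - m"] le(1) show ?case by fastforce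
qed simp

text \<open>Written in terms of v^(2j), the rotation eigenvalue, to match the scalar in
  \<open>projection_triple\<close>.\<close>

lemma eval_cheb_coeff_square:
  assumes "j \<le> k"
  shows "laurent_eval t ((cheb_coeff k j)\<^sup>2) =
    ((t + inverse t) ^ k)\<^sup>2 * (2 + v ^ (2 * j) + inverse (v ^ (2 * j))) / 4"
proof -
  have "v ^ j * inverse v ^ j = 1"
    using v_neq_0 by (simp flip: power_mult_distrib)
  then have "(v ^ j + inverse v ^ j)\<^sup>2 = 2 + v ^ (2 * j) + inverse (v ^ (2 * j))"
    by (simp add: power2_sum power_mult power_inverse mult.commute[of 2])
  then show ?thesis
    by (simp add: eval_cheb_coeff[OF assms] power_mult_distrib power_divide)
qed

end

text \<open>One specialization suffices to separate the squares. The index 0 is included because its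
  value [2]^(2k) must differ from the roots of \<open>braid_poly k\<close>.\<close>

lemma cheb_coeff_square_inj: "inj_on (\<lambda>j. (cheb_coeff k j)\<^sup>2) {0..k}"
proof (rule inj_onI)
  fix i j assume ij: "i \<in> {0..k}" "j \<in> {0..k}" and eq: "(cheb_coeff k i)\<^sup>2 = (cheb_coeff k j)\<^sup>2"
  have "{t. \<exists>v. specialization t v} \<noteq> {}"
    using infinite_specializations by fastforce
  then obtain t v where "specialization t v"
    by blast
  then interpret specialization t v .
  let ?x = "v ^ (2 * i)" and ?y = "v ^ (2 * j)"
  have "2 + ?x + inverse ?x = 2 + ?y + inverse ?y"
    using arg_cong[OF eq, of "laurent_eval t"] ij eval_two_q_neq_0
    by (simp only: eval_cheb_coeff_square atLeastAtMost_iff) simp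
  \<comment> \<open>The second factor vanishes only for i = j = 0, as \<open>v\<close> is not a root
    of unity.\<close>
  then have "(?x - ?y) * (?x * ?y - 1) = 0"
    using v_neq_0 by (simp add: field_simps)
  then have "?x = ?y \<or> v ^ (2 * i + 2 * j) = 1"
    by (simp add: power_add)
  then show "i = j"
    using v_power_inj[of "2 * i" "2 * j"] v_power[of "2 * i + 2 * j"] by auto
qed

lemma cheb_coeff_0: "cheb_coeff k 0 = two_q ^ k"
  by (simp add: cheb_coeff_eq)

section \<open>Two-dimensional representations\<close>

datatype mat2 = Mat2 (m11: complex) (m12: complex) (m21: complex) (m22: complex)

lemma mat2_eq_iff: "A = B \<longleftrightarrow> m11 A = m11 B \<and> m12 A = m12 B \<and> m21 A = m21 B \<and> m22 A = m22 B"
  by (cases A; cases B) simp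

instantiation mat2 :: ring_1
begin

definition zero_mat2 :: mat2 where
  "0 = Mat2 0 0 0 0"
definition one_mat2 :: mat2 where
  "1 = Mat2 1 0 0 1"
definition plus_mat2 :: "mat2 \<Rightarrow> mat2 \<Rightarrow> mat2" where
  "A + B = Mat2 (m11 A + m11 B) (m12 A + m12 B) (m21 A + m21 B) (m22 A + m22 B)"
definition minus_mat2 :: "mat2 \<Rightarrow> mat2 \<Rightarrow> mat2" where
  "A - B = Mat2 (m11 A - m11 B) (m12 A - m12 B) (m21 A - m21 B) (m22 A - m22 B)"
definition uminus_mat2 :: "mat2 \<Rightarrow> mat2" where
  "- A = Mat2 (- m11 A) (- m12 A) (- m21 A) (- m22 A)"
definition times_mat2 :: "mat2 \<Rightarrow> mat2 \<Rightarrow> mat2" where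
  "A * B = Mat2 (m11 A * m11 B + m12 A * m21 B) (m11 A * m12 B + m12 A * m22 B)
     (m21 A * m11 B + m22 A * m21 B) (m21 A * m12 B + m22 A * m22 B)"

lemmas mat2_defs = zero_mat2_def one_mat2_def plus_mat2_def minus_mat2_def uminus_mat2_def times_mat2_def

instance
  by standard (simp_all add: mat2_defs mat2_eq_iff algebra_simps)

end

definition smat :: "complex \<Rightarrow> mat2 \<Rightarrow> mat2" where
  "smat c A = Mat2 (c * m11 A) (c * m12 A) (c * m21 A) (c * m22 A)"

text \<open>For nonzero \<open>x\<close>, the dihedral representation in which the rotation s2 s1 is
  diagonal with entries \<open>x\<close> and \<open>inverse x\<close>.\<close>

fun reflection :: "complex \<Rightarrow> simple_refl \<Rightarrow> mat2" where
  "reflection x s1 = Mat2 0 1 1 0"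
| "reflection x s2 = Mat2 0 x (inverse x) 0"

text \<open>\<beta> times the projection onto the +1 eigenspace of the reflection; the image of a
  generator.\<close>

definition projection :: "complex \<Rightarrow> complex \<Rightarrow> simple_refl \<Rightarrow> mat2" where
  "projection \<beta> x s = smat (\<beta> / 2) (1 + reflection x s)"

lemma projection_square: "x \<noteq> 0 \<Longrightarrow> projection \<beta> x s * projection \<beta> x s = smat \<beta> (projection \<beta> x s)"
  by (cases s) (simp_all add: projection_def smat_def mat2_defs field_simps)

text \<open>These matrices have rank at most one, so a triple product is a multiple of its outer
  factor. For x = exp(2 i \<theta>) the multiple is \<beta>^2 cos(\<theta>)^2.\<close>

lemma projection_triple:
  assumes "x \<noteq> 0"
  shows "projection \<beta> x s1 * (projection \<beta> x s2 * projection \<beta> x s1) =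
      smat (\<beta>\<^sup>2 * (2 + x + inverse x) / 4) (projection \<beta> x s1)"
    and "projection \<beta> x s2 * (projection \<beta> x s1 * projection \<beta> x s2) =
      smat (\<beta>\<^sup>2 * (2 + x + inverse x) / 4) (projection \<beta> x s2)"
  using assms by (simp_all add: projection_def smat_def mat2_defs field_simps power2_eq_square)

text \<open>For \<open>x \<noteq> \<plusminus>1\<close> the representation is irreducible, so the images of the four
  alternating words are linearly independent.\<close>

lemma projection_independent:
  assumes "x \<noteq> 0" "x\<^sup>2 \<noteq> 1" "\<beta> \<noteq> 0"
    and eq: "smat p (projection \<beta> x s1) + smat q (projection \<beta> x s2)
      + smat r (projection \<beta> x s1 * projection \<beta> x s2)
      + smat s (projection \<beta> x s2 * projection \<beta> x s1) = 0"
  shows "p = 0 \<and> q = 0 \<and> r = 0 \<and> s = 0"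
proof -
  define y where "y = inverse x"
  have xy: "x * y = 1"
    using assms by (simp add: y_def)
  define r' s' where "r' = \<beta> * r / 2" and "s' = \<beta> * s / 2"
  define L where "L = smat p (projection \<beta> x s1) + smat q (projection \<beta> x s2)
      + smat r (projection \<beta> x s1 * projection \<beta> x s2)
      + smat s (projection \<beta> x s2 * projection \<beta> x s1)"
  have L: "L = Mat2 (\<beta> / 2 * (p + q + (1 + y) * r' + (1 + x) * s'))
    (\<beta> / 2 * (p + x * q + (1 + x) * (r' + s')))
    (\<beta> / 2 * (p + y * q + (1 + y) * (r' + s')))
    (\<beta> / 2 * (p + q + (1 + x) * r' + (1 + y) * s'))"
    unfolding L_def projection_def smat_def mat2_defs reflection.simps mat2.sel y_def[symmetric] r'_def s'_def
    by (simp add: field_simps)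
  have e: "p + q + (1 + y) * r' + (1 + x) * s' = 0"
    "p + x * q + (1 + x) * (r' + s') = 0"
    "p + y * q + (1 + y) * (r' + s') = 0"
    "p + q + (1 + x) * r' + (1 + y) * s' = 0"
    using eq[folded L_def] \<open>\<beta> \<noteq> 0\<close> unfolding L zero_mat2_def by simp_all
  have nz: "x - y \<noteq> 0" "1 - x \<noteq> 0" "1 + x \<noteq> 0"
    using assms(1,2) by (auto simp: y_def field_simps power2_eq_square add_eq_0_iff)
  have "(x - y) * (s' - r') = 0"
    using e(1,4) by algebra
  with nz have rs: "s' = r'" by simp
  \<comment> \<open>The second equation is compared with \<open>x\<close> times the third.\<close>
  have "(1 - x) * (q - p) = 0"
    using e(2,3) xy by algebra
  with nz have q: "q = p" by simp
  have "(1 + x) * (p + 2 * r') = 0"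
    using e(2) unfolding q rs by algebra
  with nz have p: "p = - 2 * r'"
    by (simp add: add_eq_0_iff)
  \<comment> \<open>The first equation has become (x + y - 2) r' = 0; it is multiplied by
    \<open>x\<close>.\<close>
  have "(1 - x) * (1 - x) * r' = 0"
    using e(1) xy unfolding q p rs by algebra
  with nz have "r' = 0" by simp
  with rs q p \<open>\<beta> \<noteq> 0\<close> show ?thesis
    by (simp add: r'_def s'_def)
qed

context specialization
begin

text \<open>Makes the matrices an algebra over the Laurent polynomials through the specialization,
  so that \<open>free_eval\<close> and \<open>poly_eval\<close> apply to them.\<close>

definition mat_scale :: "laurent \<Rightarrow> mat2 \<Rightarrow> mat2" where
  "mat_scale c = smat (laurent_eval t c)"

end

sublocale specialization \<subseteq> mat: unital_algebra mat_scale
  by standard (simp_all add: mat_scale_def smat_def mat2_defs algebra_simps)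

section \<open>Matrix representations of the presented algebra\<close>

context specialization
begin

definition rep :: "nat \<Rightarrow> complex \<Rightarrow> (simple_refl, laurent) free_algebra \<Rightarrow> mat2" where
  "rep k x = mat.free_eval (projection ((t + inverse t) ^ k) x)"

lemma eval_two_q_power [simp]: "laurent_eval t (two_q ^ k) = (t + inverse t) ^ k"
  by simp

text \<open>For positive \<open>j\<close> the scalar of the triple products is a root of
  \<open>braid_poly k\<close>, so both sides of the braid relation vanish.\<close>

lemma rep_relations:
  assumes "r \<in> nonstd_relations (two_q ^ k) (braid_poly k)" and "j \<le> k"
    and x: "x = v ^ (2 * j) \<or> x = inverse (v ^ (2 * j))"
  shows "rep k x r = 0"
proof -
  have "x \<noteq> 0"
    using x v_neq_0 by auto
  let ?E = "projection ((t + inverse t) ^ k) x" and ?c = "(cheb_coeff k j)\<^sup>2"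
  have "laurent_eval t ?c = ((t + inverse t) ^ k)\<^sup>2 * (2 + x + inverse x) / 4"
    unfolding eval_cheb_coeff_square[OF \<open>j \<le> k\<close>] using x by (auto simp: add_ac)
  then have c: "?E s1 * (?E s2 * ?E s1) = mat_scale ?c (?E s1)"
    "?E s2 * (?E s1 * ?E s2) = mat_scale ?c (?E s2)"
    unfolding mat_scale_def by (simp_all only: projection_triple[OF \<open>x \<noteq> 0\<close>])
  have "?E s1 * mat.poly_eval (braid_poly k) (?E s2 * ?E s1) =
      ?E s2 * mat.poly_eval (braid_poly k) (?E s1 * ?E s2)"
  proof (cases "j = 0")
    \<comment> \<open>Here x = 1 and the two reflections coincide.\<close>
    case True
    with x have "?E s1 = ?E s2"
      by (auto simp: projection_def)
    then show ?thesis by simp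
  next
    case False
    then have "poly (braid_poly k) ?c = 0"
      using \<open>j \<le> k\<close> by (auto simp: braid_poly_def poly_prod prod_zero_iff)
    then show ?thesis
      by (simp add: mat.eigen_poly_eval[OF c(1)] mat.eigen_poly_eval[OF c(2)])
  qed
  moreover have "?E s * ?E s = mat_scale (two_q ^ k) (?E s)" for s
    unfolding mat_scale_def eval_two_q_power by (rule projection_square[OF \<open>x \<noteq> 0\<close>])
  ultimately show ?thesis
    using assms(1) unfolding nonstd_relations_def rep_def
    by (auto simp: mat.free_eval_diff mat.free_eval_mult mat.free_eval_var mat.free_eval_scale
        mat.free_eval_poly_eval)
qed

lemma rep_alternating_form:
  fixes j k defines "E \<equiv> projection ((t + inverse t) ^ k) (v ^ (2 * j))" and "c \<equiv> (cheb_coeff k j)\<^sup>2"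
  assumes "j \<le> k"
  shows "rep k (v ^ (2 * j)) (alternating_form \<alpha> P Q R S) = mat_scale \<alpha> 1
    + mat_scale (poly P c) (E s1) + mat_scale (poly Q c) (E s2)
    + mat_scale (poly R c) (E s1 * E s2) + mat_scale (poly S c) (E s2 * E s1)"
proof -
  have "v ^ (2 * j) \<noteq> 0"
    using v_neq_0 by simp
  then have c: "E s1 * (E s2 * E s1) = mat_scale c (E s1)" "E s2 * (E s1 * E s2) = mat_scale c (E s2)"
    unfolding mat_scale_def c_def E_def eval_cheb_coeff_square[OF \<open>j \<le> k\<close>]
    by (rule projection_triple)+
  then have "E s1 * E s2 * (E s1 * E s2) = mat_scale c (E s1 * E s2)"
    "E s2 * E s1 * (E s2 * E s1) = mat_scale c (E s2 * E s1)"
    by (simp_all add: mult.assoc mat.scale_mult_right)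
  note eigen = c this
  show ?thesis
    unfolding alternating_form_def rep_def
    by (simp add: mat.free_eval_add mat.free_eval_mult mat.free_eval_var mat.free_eval_scale
        mat.free_eval_one mat.free_eval_poly_eval eigen[THEN mat.eigen_poly_eval] flip: E_def)
qed

end

text \<open>The irreducible cases 1 \<le> j \<le> k give divisibility of the four polynomials by
  \<open>braid_poly k\<close>, and j = 0 gives the two remaining linear conditions of
  \<open>alternating_form_in_ideal\<close>.\<close>

lemma alternating_form_zero:
  assumes rep: "\<And>t v j. specialization t v \<Longrightarrow> j \<le> k \<Longrightarrow>
    specialization.rep t k (v ^ (2 * j)) (alternating_form \<alpha> P Q R S) = 0"
  shows "alternating_form \<alpha> P Q R S \<in> two_sided_ideal (nonstd_relations (two_q ^ k) (braid_poly k))"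
proof -
  \<comment> \<open>At j = 0 both generators act as the same matrix E with E^2 = \<beta> E, so the
    form is a combination of 1 and E, which are independent.\<close>
  have \<alpha>_sum: "laurent_eval t \<alpha> = 0 \<and>
      laurent_eval t (poly (P + Q + smult (two_q ^ k) R + smult (two_q ^ k) S) ((two_q ^ k)\<^sup>2)) = 0"
    if "specialization t v" for t v
  proof -
    interpret specialization t v by fact
    define \<beta> where "\<beta> = (t + inverse t) ^ k"
    have "\<beta> \<noteq> 0"
      using eval_two_q_neq_0 by (simp add: \<beta>_def)
    show ?thesis
      using rep[OF that, of 0] \<open>\<beta> \<noteq> 0\<close> unfolding rep_alternating_form[OF le0] \<beta>_def[symmetric]
      by (simp add: cheb_coeff_0 projection_def smat_def mat2_defs mat_scale_def \<beta>_def[symmetric]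
          algebra_simps power2_eq_square) algebra
  qed
  then have \<alpha>: "\<alpha> = 0"
    and sum: "poly (P + Q + smult (two_q ^ k) R + smult (two_q ^ k) S) ((two_q ^ k)\<^sup>2) = 0"
    unfolding laurent_eq_0_iff_eval by blast+
  have "laurent_eval t (poly P ((cheb_coeff k j)\<^sup>2)) = 0 \<and> laurent_eval t (poly Q ((cheb_coeff k j)\<^sup>2)) = 0 \<and>
      laurent_eval t (poly R ((cheb_coeff k j)\<^sup>2)) = 0 \<and> laurent_eval t (poly S ((cheb_coeff k j)\<^sup>2)) = 0"
    if "specialization t v" "j \<in> {1..k}" for t v j
  proof -
    interpret specialization t v by fact
    have "j \<le> k" "0 < 2 * j * 2"
      using that by auto
    have "v ^ (2 * j) \<noteq> 0" "(v ^ (2 * j))\<^sup>2 \<noteq> 1" "(t + inverse t) ^ k \<noteq> 0"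
      using v_neq_0 v_power[OF \<open>0 < 2 * j * 2\<close>] eval_two_q_neq_0
      by (simp_all only: power_mult[symmetric] power_not_zero not_False_eq_True)
    then show ?thesis
      using rep[OF that(1) \<open>j \<le> k\<close>] unfolding rep_alternating_form[OF \<open>j \<le> k\<close>] \<alpha>
      by (intro projection_independent) (simp_all add: mat_scale_def smat_def mat2_defs)
  qed
  then have root: "poly P ((cheb_coeff k j)\<^sup>2) = 0" "poly Q ((cheb_coeff k j)\<^sup>2) = 0"
    "poly R ((cheb_coeff k j)\<^sup>2) = 0" "poly S ((cheb_coeff k j)\<^sup>2) = 0" if "j \<in> {1..k}" for j
    using that unfolding laurent_eq_0_iff_eval by blast+
  have "inj_on (\<lambda>j. (cheb_coeff k j)\<^sup>2) {1..k}"
    by (rule inj_on_subset[OF cheb_coeff_square_inj]) auto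
  then have dvd: "braid_poly k dvd P" "braid_poly k dvd Q" "braid_poly k dvd R" "braid_poly k dvd S"
    unfolding braid_poly_def by (intro prod_linear_dvd root; simp)+
  \<comment> \<open>[2]^k is the Chebyshev value of index 0, distinct up to sign from those of index
    1 to k.\<close>
  have "poly (braid_poly k) ((two_q ^ k)\<^sup>2) \<noteq> 0"
  proof
    assume "poly (braid_poly k) ((two_q ^ k)\<^sup>2) = 0"
    then obtain j where "j \<in> {1..k}" "(two_q ^ k)\<^sup>2 = (cheb_coeff k j)\<^sup>2"
      by (auto simp: braid_poly_def poly_prod)
    then show False
      using inj_onD[OF cheb_coeff_square_inj, of k 0 j] by (simp add: cheb_coeff_0)
  qed
  with dvd sum show ?thesis
    unfolding \<alpha> by (intro alternating_form_in_ideal)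
qed

section \<open>Representations of the Hecke algebra\<close>

lemma sum_S3:
  "(\<Sum>w\<in>UNIV. f w) = f (word_perm []) + f (word_perm [s1]) + f (word_perm [s2])
    + f (word_perm [s1, s2]) + f (word_perm [s2, s1]) + (f (word_perm [s1, s2, s1]) :: 'a::comm_monoid_add)"
proof -
  have "UNIV = set (map word_perm [[], [s1], [s2], [s1,s2], [s2,s1], [s1,s2,s1]])"
    using all_S3[of "\<lambda>w. w \<in> set (map word_perm [[], [s1], [s2], [s1,s2], [s2,s1], [s1,s2,s1]])"] by auto
  then have "(\<Sum>w\<in>UNIV. f w) = sum f (set (map word_perm [[], [s1], [s2], [s1,s2], [s2,s1], [s1,s2,s1]]))"
    by (rule arg_cong)
  also have "\<dots> = sum_list (map f (map word_perm [[], [s1], [s2], [s1,s2], [s2,s1], [s1,s2,s1]]))"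
    by (rule sum.distinct_set_conv_list[OF word_perm_neq])
  finally show ?thesis
    by (simp only: list.map sum_list.Cons sum_list.Nil add.assoc add_0_right)
qed

lemma hecke_coeff_T_mult: "hecke_coeff (T (refl_perm s) * h) = left_refl s (hecke_coeff h)"
proof -
  have "left_T (refl_perm s) x = left_refl s x" for x
    using left_T_table(2,3) by (cases s) (simp_all add: word_perm_def)
  then show ?thesis
    by (simp add: times_hecke3_def T_def hecke_mult_def if_distrib[of "\<lambda>a. a * _"] cong: if_cong)
qed

definition hecke_refl :: "simple_refl \<Rightarrow> hecke3" where
  "hecke_refl s = C_sign s Plus + C_sign s Minus"

lemma hecke_refl_eq: "hecke_refl s = T (refl_perm s) + T (refl_perm s) - hecke_scale (u - u_inv) 1"
  by (simp add: hecke_refl_def hecke3.scale_left_diff_distrib)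

text \<open>With C C' = 0 and C' = C + [2] one has C^2 = -[2] C, and (2 C + [2])^2 reduces to
  [2]^2.\<close>

lemma hecke_refl_square: "hecke_refl s * hecke_refl s = hecke_scale (two_q\<^sup>2) 1"
proof -
  define p m where "p = C_sign s Plus" and "m = C_sign s Minus"
  have mp: "m * p = 0"
    using T_quadratic[of s] by (simp add: p_def m_def)
  have p: "p = m + hecke_scale two_q 1"
    by (simp add: p_def m_def two_q_def hecke3.scale_left_distrib)
  from mp have "m * m = - hecke_scale two_q m"
    by (simp add: p distrib_left hecke3.scale_mult_right eq_neg_iff_add_eq_0)
  then show ?thesis
    unfolding hecke_refl_def p_def[symmetric] m_def[symmetric] p
    by (simp add: distrib_left distrib_right hecke3.scale_mult_right hecke3.scale_mult_left
        hecke3.scale_right_distrib power2_eq_square)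
qed

definition hecke_word :: "simple_refl list \<Rightarrow> hecke3" where
  "hecke_word ws = prod_list (map hecke_refl ws)"

text \<open>The scale \<open>b\<close> is [2] for one tensor factor and [2]^k for the whole tensor
  power.\<close>

definition reflection_word :: "complex \<Rightarrow> complex \<Rightarrow> simple_refl list \<Rightarrow> mat2" where
  "reflection_word b x ws = prod_list (map (\<lambda>s. smat b (reflection x s)) ws)"

context specialization
begin

text \<open>Solves \<tau> = 2 T - (u - 1/u) for T when \<tau> acts as [2] times a
  reflection.\<close>

definition T_matrix :: "complex \<Rightarrow> simple_refl \<Rightarrow> mat2" where
  "T_matrix x s = smat (1 / 2) (smat (t + inverse t) (reflection x s) + smat (t - inverse t) 1)"

definition hecke_rep :: "complex \<Rightarrow> hecke3 \<Rightarrow> mat2" where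
  "hecke_rep x h = (\<Sum>w\<in>UNIV. mat_scale (hecke_coeff h w) (prod_list (map (T_matrix x) (reduced_word w))))"

lemma T_matrix_quadratic:
  assumes "x \<noteq> 0"
  shows "T_matrix x s * T_matrix x s = 1 + mat_scale (u - u_inv) (T_matrix x s)"
  using assms t_neq_0
  by (cases s) (simp_all add: T_matrix_def smat_def mat2_defs mat_scale_def field_simps power2_eq_square)

text \<open>The three values of \<open>x\<close> are the eigenvalues of the product of the two normalized reflections
  in the Hecke algebra.\<close>

lemma T_matrix_braid:
  assumes "x \<in> {1, v\<^sup>2, inverse (v\<^sup>2)}"
  shows "T_matrix x s1 * (T_matrix x s2 * T_matrix x s1) = T_matrix x s2 * (T_matrix x s1 * T_matrix x s2)"
proof -
  have "x \<noteq> 0"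
    using assms v_neq_0 by auto
  define y b q where "y = inverse x" and "b = (t + inverse t) / 2" and "q = (t - inverse t) / 2"
  have xy: "x * y = 1"
    using \<open>x \<noteq> 0\<close> by (simp add: y_def)
  have "b\<^sup>2 * (v + inverse v)\<^sup>2 = 1"
    using two_q_v unfolding b_def power_mult_distrib[symmetric] by simp
  moreover have "(v + inverse v)\<^sup>2 = v\<^sup>2 + 2 + inverse (v\<^sup>2)"
    using v_neq_0 by (simp add: field_simps power2_eq_square)
  ultimately have x: "x = 1 \<or> b\<^sup>2 * (x + 2 + y) = 1"
    using assms unfolding y_def by (auto simp: add_ac)
  have bq: "b\<^sup>2 = q\<^sup>2 + 1"
    using t_neq_0 by (simp add: b_def q_def field_simps power2_eq_square)
  have yx: "y - x\<^sup>2 = (1 - x) * (x + 1 + y)" "x - y\<^sup>2 = (1 - y) * (x + 1 + y)"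
    using xy by algebra+
  have *: "b\<^sup>2 * (y - x\<^sup>2) + q\<^sup>2 * (1 - x) = (b\<^sup>2 * (x + 1 + y) + q\<^sup>2) * (1 - x)"
    "b\<^sup>2 * (x - y\<^sup>2) + q\<^sup>2 * (1 - y) = (b\<^sup>2 * (x + 1 + y) + q\<^sup>2) * (1 - y)"
    unfolding yx by (simp_all add: algebra_simps)
  \<comment> \<open>Besides x = 1, the braid relation requires b^2 (x + 1 + y) + q^2 = 0, which is
    b^2 (x + 2 + y) = 1 because q^2 = b^2 - 1.\<close>
  have **: "b\<^sup>2 * (y - x\<^sup>2) + q\<^sup>2 * (1 - x) = 0 \<and> b\<^sup>2 * (x - y\<^sup>2) + q\<^sup>2 * (1 - y) = 0"
  proof (cases "x = 1")
    case True
    with xy show ?thesis by simp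
  next
    case False
    with x bq have "b\<^sup>2 * (x + 1 + y) + q\<^sup>2 = 0"
      by (simp add: algebra_simps)
    then show ?thesis
      unfolding * by simp
  qed
  have T: "T_matrix x s1 = Mat2 q b b q" "T_matrix x s2 = Mat2 q (b * x) (b * y) q"
    by (simp_all add: T_matrix_def smat_def mat2_defs b_def q_def y_def)
  have "T_matrix x s1 * (T_matrix x s2 * T_matrix x s1) - T_matrix x s2 * (T_matrix x s1 * T_matrix x s2) =
    Mat2 (q * b\<^sup>2 * (1 - x * y)) (b * (b\<^sup>2 * (y - x\<^sup>2) + q\<^sup>2 * (1 - x)))
      (b * (b\<^sup>2 * (x - y\<^sup>2) + q\<^sup>2 * (1 - y))) (q * b\<^sup>2 * (1 - x * y))"
    unfolding T times_mat2_def minus_mat2_def mat2.sel mat2.inject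
    by (simp add: algebra_simps power2_eq_square)
  also have "\<dots> = 0"
    using ** xy by (simp add: zero_mat2_def)
  finally show ?thesis by simp
qed

text \<open>The matrix quadratic and braid relations reduce each product to the six chosen words,
  reproducing the table of \<open>left_refl\<close>.\<close>

lemma hecke_rep_T_mult:
  assumes x: "x \<in> {1, v\<^sup>2, inverse (v\<^sup>2)}"
  shows "hecke_rep x (T (refl_perm s) * h) = T_matrix x s * hecke_rep x h"
proof -
  have "x \<noteq> 0"
    using x v_neq_0 by auto
  let ?A = "T_matrix x s1" and ?B = "T_matrix x s2"
  note quad = T_matrix_quadratic[OF \<open>x \<noteq> 0\<close>]
  have quad': "T_matrix x s * (T_matrix x s * C) = C + mat_scale (u - u_inv) (T_matrix x s * C)" for s C
    by (simp only: mult.assoc[symmetric] quad distrib_right mult_1_left mat.scale_mult_left)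
  have braid: "?B * (?A * ?B) = ?A * (?B * ?A)"
    by (rule T_matrix_braid[OF x, symmetric])
  have "?B * (?A * (?B * ?A)) = ?A * ?B * (?A * ?A)"
    by (simp only: mult.assoc[symmetric] braid[unfolded mult.assoc[symmetric]])
  then have braid': "?B * (?A * (?B * ?A)) = ?A * ?B + mat_scale (u - u_inv) (?A * (?B * ?A))"
    by (simp add: quad distrib_left mat.scale_mult_right mult.assoc)
  have long: "prod_list (map (T_matrix x) (reduced_word (word_perm [s1, s2, s1]))) = ?A * (?B * ?A)"
    using reduced_words(6) braid by auto
  have rep: "hecke_rep x g = mat_scale (hecke_coeff g (word_perm [])) 1 + mat_scale (hecke_coeff g (word_perm [s1])) ?A
      + mat_scale (hecke_coeff g (word_perm [s2])) ?B + mat_scale (hecke_coeff g (word_perm [s1, s2])) (?A * ?B)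
      + mat_scale (hecke_coeff g (word_perm [s2, s1])) (?B * ?A)
      + mat_scale (hecke_coeff g (word_perm [s1, s2, s1])) (?A * (?B * ?A))" for g
    unfolding hecke_rep_def sum_S3 long by (simp add: reduced_words(1-5))
  show ?thesis
    unfolding rep hecke_coeff_T_mult
    by (cases s) (simp_all add: left_refl_table mat.scale_left_distrib mat.scale_right_distrib distrib_left
        mat.scale_mult_right quad quad' braid braid' mult.assoc mult.commute[of _ "u - u_inv"] add_ac)
qed

lemma hecke_rep_add: "hecke_rep x (g + h) = hecke_rep x g + hecke_rep x h"
  by (simp add: hecke_rep_def plus_hecke3_def mat.scale_left_distrib sum.distrib)

lemma hecke_rep_scale: "hecke_rep x (hecke_scale c h) = mat_scale c (hecke_rep x h)"
  by (simp add: hecke_rep_def hecke_scale_def mat.scale_sum_right)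

lemma hecke_rep_1: "hecke_rep x 1 = 1"
  unfolding hecke_rep_def sum_S3 one_hecke3_def T_def coeff_Hecke word_perm_Nil[symmetric]
  using word_perm_neq by (auto simp: reduced_words(1))

lemma hecke_rep_word:
  assumes "x \<in> {1, v\<^sup>2, inverse (v\<^sup>2)}"
  shows "hecke_rep x (hecke_word ws) = reflection_word (t + inverse t) x ws"
proof (induction ws)
  case Nil
  show ?case by (simp add: hecke_word_def reflection_word_def hecke_rep_1)
next
  case (Cons s ws)
  let ?h = "hecke_word ws"
  have "hecke_word (s # ws) = T (refl_perm s) * ?h + T (refl_perm s) * ?h + hecke_scale (u_inv - u) ?h"
    by (simp add: hecke_word_def hecke_refl_eq distrib_right left_diff_distrib hecke3.scale_mult_left
        hecke3.scale_left_diff_distrib)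
  then have "hecke_rep x (hecke_word (s # ws)) =
      (T_matrix x s + T_matrix x s + mat_scale (u_inv - u) 1) * hecke_rep x ?h"
    by (simp add: hecke_rep_add hecke_rep_scale hecke_rep_T_mult[OF assms] distrib_right mat.scale_mult_left)
  also have "T_matrix x s + T_matrix x s + mat_scale (u_inv - u) 1 = smat (t + inverse t) (reflection x s)"
    by (simp add: T_matrix_def mat_scale_def smat_def mat2_defs)
  finally show ?case
    by (simp add: Cons.IH reflection_word_def)
qed

end

section \<open>Functionals on tensor powers\<close>

lemma tensor_sum:
  fixes g :: "'k::finite \<Rightarrow> sign \<Rightarrow> hecke3"
  shows "tensor (\<lambda>i. g i Plus + g i Minus) = (\<Sum>a\<in>UNIV. tensor (\<lambda>i. g i (a i)))"
proof (rule tensor_eqI)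
  fix w
  have UNIV: "(UNIV :: sign set) = {Plus, Minus}"
    using sign.exhaust by blast
  have "(\<Sum>a\<in>UNIV. f a) = f Plus + f Minus" for f :: "sign \<Rightarrow> laurent"
    unfolding UNIV by simp
  then show "tensor_coeff (tensor (\<lambda>i. g i Plus + g i Minus)) w =
      tensor_coeff (\<Sum>a\<in>UNIV. tensor (\<lambda>i. g i (a i))) w"
    using prod_sum_UNIV[of "\<lambda>i a. hecke_coeff (g i a) (w i)"]
    by (simp add: tensor_coeff_sum tensor_def plus_hecke3_def)
qed

lemma tensor_const_scale:
  "tensor (\<lambda>_::'k::finite. hecke_scale c 1) = tensor_scale (c ^ CARD('k)) 1"
  by (rule tensor_eqI)
    (simp add: tensor_scale_def one_hecke_tensor_def tensor_def hecke_scale_def prod.distrib)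

text \<open>Summing the tensors of \<open>C\<close>-elements with all signs, respectively with the parity as
  weight, gives the two terms on the right.\<close>

lemma nonstd_gen_double:
  "nonstd_gen s + nonstd_gen s =
    tensor_scale (two_q ^ CARD('k)) 1 + tensor (\<lambda>_::'k::finite. hecke_refl s)"
proof -
  let ?E = "{a :: 'k \<Rightarrow> sign. even (card {i. a i = Minus})}"
  let ?t = "\<lambda>a :: 'k \<Rightarrow> sign. tensor (\<lambda>i. C_sign s (a i))"
  define h where "h = (\<lambda>a. case a of Plus \<Rightarrow> C_sign s Plus | Minus \<Rightarrow> - C_sign s Minus)"
  have sign: "tensor (\<lambda>i. h (a i)) = (if a \<in> ?E then ?t a else - ?t a)" for a :: "'k \<Rightarrow> sign"
  proof (rule tensor_eqI)
    fix w
    have "hecke_coeff (h (a i)) (w i) =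
        (if a i = Minus then - 1 else 1) * hecke_coeff (C_sign s (a i)) (w i)" for i
      by (cases "a i") (simp_all add: h_def uminus_hecke3_def)
    then have "(\<Prod>i\<in>UNIV. hecke_coeff (h (a i)) (w i)) =
        (- 1) ^ card {i. a i = Minus} * (\<Prod>i\<in>UNIV. hecke_coeff (C_sign s (a i)) (w i))"
      by (simp add: prod.distrib prod.If_cases)
    then show "tensor_coeff (tensor (\<lambda>i. h (a i))) w = tensor_coeff (if a \<in> ?E then ?t a else - ?t a) w"
      by (simp add: tensor_def uminus_hecke_tensor_def)
  qed
  \<comment> \<open>The sum weighted by parity is the tensor power of C' - C, a scalar.\<close>
  have "C_sign s Plus - C_sign s Minus = hecke_scale two_q 1"
    by (simp add: two_q_def hecke3.scale_left_distrib)
  then have "tensor_scale (two_q ^ CARD('k)) 1 = tensor (\<lambda>_::'k. h Plus + h Minus)"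
    by (simp add: h_def tensor_const_scale)
  also have "\<dots> = (\<Sum>a\<in>UNIV. if a \<in> ?E then ?t a else - ?t a)"
    unfolding tensor_sum[of "\<lambda>_. h"] sign by (rule refl)
  finally have "tensor_scale (two_q ^ CARD('k)) 1 + tensor (\<lambda>_::'k. hecke_refl s) =
      (\<Sum>a\<in>UNIV. (if a \<in> ?E then ?t a else - ?t a) + ?t a)"
    unfolding hecke_refl_def tensor_sum[of "\<lambda>_. C_sign s"] sum.distrib by (rule arg_cong)
  \<comment> \<open>Terms with an odd number of minus signs cancel, the others double.\<close>
  also have "\<dots> = (\<Sum>a\<in>UNIV. if a \<in> ?E then ?t a + ?t a else 0)"
    by (rule sum.cong) simp_all
  also have "\<dots> = (\<Sum>a\<in>?E. ?t a + ?t a)"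
    by (simp add: sum.If_cases)
  also have "\<dots> = nonstd_gen s + nonstd_gen s"
    by (simp add: nonstd_gen_def sum.distrib)
  finally show ?thesis ..
qed

text \<open>Indices are booleans, \<open>True\<close> being the first, so that a monomial matrix
  switches rows by negation.\<close>

definition entry :: "bool \<Rightarrow> bool \<Rightarrow> mat2 \<Rightarrow> complex" where
  "entry a c A = (if a then if c then m11 A else m12 A else if c then m21 A else m22 A)"

lemma mat2_eq_0_iff: "A = 0 \<longleftrightarrow> (\<forall>a c. entry a c A = 0)"
  unfolding entry_def all_bool_eq by (auto simp: mat2_eq_iff zero_mat2_def)

lemma entry_simps [simp]:
  "entry a c 0 = 0" "entry a c 1 = (if a = c then 1 else 0)"
  "entry a c (A + B) = entry a c A + entry a c B" "entry a c (smat k A) = k * entry a c A"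
  by (auto simp: entry_def mat2_defs smat_def)

lemma entry_sum: "entry a c (sum f I) = (\<Sum>i\<in>I. entry a c (f i))"
  by (induction I rule: infinite_finite_induct) simp_all

text \<open>The matrices are monomial, so their entries multiply under tensor products.\<close>

lemma entry_reflection_word_Cons:
  "entry a c (reflection_word b x (s # ws)) =
    b * (if s = s1 then 1 else if a then x else inverse x) * entry (\<not> a) c (reflection_word b x ws)"
  by (cases s) (simp_all add: reflection_word_def entry_def smat_def mat2_defs)

text \<open>Each letter switches the row, so the parity of the length decides which entries can be
  nonzero.\<close>

lemma entry_reflection_word_eq_0:
  "(a = c) \<noteq> even (length ws) \<Longrightarrow> entry a c (reflection_word b x ws) = 0"
proof (induction ws arbitrary: a)
  case Nil
  then show ?case by (simp add: reflection_word_def)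
next
  case (Cons s ws)
  then show ?case by (cases a; cases c) (simp_all add: entry_reflection_word_Cons)
qed

text \<open>At a fixed position the entry is zero or a power of \<open>b\<close> times an integral
  power of \<open>x\<close>, the same powers for every factor.\<close>

lemma prod_entry_reflection_word:
  fixes x :: "'k::finite \<Rightarrow> complex"
  shows "(\<Prod>i\<in>UNIV. entry a c (reflection_word b (x i) ws)) =
    entry a c (reflection_word (b ^ CARD('k)) (\<Prod>i\<in>UNIV. x i) ws)"
proof (induction ws arbitrary: a)
  case Nil
  then show ?case by (simp add: reflection_word_def)
next
  case (Cons s ws)
  have "(\<Prod>i\<in>UNIV. if s = s1 then 1 else if a then x i else inverse (x i)) =
      (if s = s1 then 1 else if a then \<Prod>i\<in>UNIV. x i else inverse (\<Prod>i\<in>UNIV. x i))"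
    by (simp add: prod_inversef[symmetric] comp_def)
  then show ?case
    by (simp only: entry_reflection_word_Cons prod.distrib Cons.IH prod_constant)
qed

section \<open>Functionals given by matrix entries\<close>

context specialization
begin

definition functional :: "(S3 \<Rightarrow> complex) \<Rightarrow> hecke3 \<Rightarrow> complex" where
  "functional \<phi> h = (\<Sum>w\<in>UNIV. laurent_eval t (hecke_coeff h w) * \<phi> w)"

definition tensor_functional :: "('k::finite \<Rightarrow> S3 \<Rightarrow> complex) \<Rightarrow> 'k hecke_tensor \<Rightarrow> complex" where
  "tensor_functional \<phi> x = (\<Sum>w\<in>UNIV. laurent_eval t (tensor_coeff x w) * (\<Prod>i\<in>UNIV. \<phi> i (w i)))"

lemma functional_add: "functional \<phi> (g + h) = functional \<phi> g + functional \<phi> h"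
  by (simp add: functional_def plus_hecke3_def distrib_right sum.distrib)

lemma functional_diff: "functional \<phi> (g - h) = functional \<phi> g - functional \<phi> h"
  by (simp add: functional_def minus_hecke3_def left_diff_distrib sum_subtractf)

lemma functional_scale: "functional \<phi> (hecke_scale c h) = laurent_eval t c * functional \<phi> h"
  by (simp add: functional_def hecke_scale_def sum_distrib_left mult.assoc)

lemma functional_T: "functional \<phi> (T w) = \<phi> w"
  by (simp add: functional_def T_def if_distrib[of "laurent_eval t"] if_distrib[of "\<lambda>a. a * _"] cong: if_cong)

lemma tensor_functional_0: "tensor_functional \<phi> 0 = 0"
  by (simp add: tensor_functional_def zero_hecke_tensor_def)

lemma tensor_functional_add:
  "tensor_functional \<phi> (x + y) = tensor_functional \<phi> x + tensor_functional \<phi> y"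
  by (simp add: tensor_functional_def plus_hecke_tensor_def distrib_right sum.distrib)

lemma tensor_functional_scale:
  "tensor_functional \<phi> (tensor_scale c x) = laurent_eval t c * tensor_functional \<phi> x"
  by (simp add: tensor_functional_def tensor_scale_def sum_distrib_left mult.assoc)

lemma tensor_functional_tensor:
  "tensor_functional \<phi> (tensor h) = (\<Prod>i\<in>UNIV. functional (\<phi> i) (h i))"
  by (simp add: functional_def prod_sum_UNIV tensor_functional_def tensor_def prod.distrib)

text \<open>Twice a generator is [2]^k plus the tensor power of \<tau>, so its last occurrence
  either disappears or prepends a letter to \<open>ws\<close>. The factor \<open>g\<close> is 1 or 0
  in the applications.\<close>

lemma tensor_functional_gens:
  fixes \<phi> :: "'k::finite \<Rightarrow> S3 \<Rightarrow> complex"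
  defines "\<beta> \<equiv> (t + inverse t) ^ CARD('k)"
  assumes word: "\<And>ws. tensor_functional \<phi> (tensor (\<lambda>_. hecke_word ws)) =
    g * entry a c (reflection_word \<beta> x ws)"
  shows "tensor_functional \<phi> (prod_list (map nonstd_gen us) * tensor (\<lambda>_. hecke_word ws)) =
    g * entry a c (prod_list (map (projection \<beta> x) us) * reflection_word \<beta> x ws)"
proof (induction us arbitrary: ws rule: rev_induct)
  case Nil
  show ?case by (simp add: word)
next
  case (snoc s us)
  let ?P = "prod_list (map nonstd_gen us) :: 'k hecke_tensor"
  let ?h = "tensor (\<lambda>_. hecke_word ws) :: 'k hecke_tensor"
  let ?E = "prod_list (map (projection \<beta> x) us)" and ?M = "reflection_word \<beta> x ws"
  have "tensor (\<lambda>_. hecke_refl s) * ?h = tensor (\<lambda>_. hecke_word (s # ws))"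
    by (simp add: tensor_mult hecke_word_def)
  then have "(nonstd_gen s + nonstd_gen s) * ?h =
      tensor_scale (two_q ^ CARD('k)) ?h + tensor (\<lambda>_. hecke_word (s # ws))"
    by (simp add: nonstd_gen_double distrib_right hecke_tensor.scale_mult_left)
  from arg_cong[OF this, of "\<lambda>y. ?P * y"]
  have "?P * (nonstd_gen s * ?h) + ?P * (nonstd_gen s * ?h) =
      tensor_scale (two_q ^ CARD('k)) (?P * ?h) + ?P * tensor (\<lambda>_. hecke_word (s # ws))"
    by (simp only: distrib_left distrib_right hecke_tensor.scale_mult_right)
  from arg_cong[OF this, of "tensor_functional \<phi>"]
  have "2 * tensor_functional \<phi> (?P * (nonstd_gen s * ?h)) =
      \<beta> * tensor_functional \<phi> (?P * ?h) + tensor_functional \<phi> (?P * tensor (\<lambda>_. hecke_word (s # ws)))"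
    by (simp only: tensor_functional_add tensor_functional_scale eval_two_q_power \<beta>_def mult_2)
  also have "\<dots> = \<beta> * (g * entry a c (?E * ?M)) + g * entry a c (?E * reflection_word \<beta> x (s # ws))"
    unfolding snoc.IH ..
  also have "\<dots> = g * entry a c (smat \<beta> (?E * ?M) + ?E * reflection_word \<beta> x (s # ws))"
    by (simp add: distrib_left)
  also have "smat \<beta> (?E * ?M) + ?E * reflection_word \<beta> x (s # ws) = smat 2 (?E * (projection \<beta> x s * ?M))"
    by (simp add: reflection_word_def projection_def smat_def mat2_defs algebra_simps)
  finally show ?case
    by (simp add: mult.assoc)
qed

lemma tensor_functional_free_eval:
  fixes \<phi> :: "'k::finite \<Rightarrow> S3 \<Rightarrow> complex"
  assumes word: "\<And>ws. tensor_functional \<phi> (tensor (\<lambda>_. hecke_word ws)) =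
    g * entry a c (reflection_word ((t + inverse t) ^ CARD('k)) x ws)"
  shows "tensor_functional \<phi> (hecke_tensor.free_eval nonstd_gen p) = g * entry a c (rep CARD('k) x p)"
proof (induction p rule: free_algebra_induct)
  case (single w r)
  have "tensor (\<lambda>_::'k. hecke_word []) = 1"
    by (simp add: hecke_word_def one_hecke_tensor_def)
  then show ?case
    using tensor_functional_gens[OF word, of "letters w" "[]"]
    by (simp add: hecke_tensor.free_eval_single tensor_functional_scale rep_def mat.free_eval_single
        mat_scale_def reflection_word_def)
next
  case (add p q)
  then show ?case
    by (simp add: hecke_tensor.free_eval_add tensor_functional_add rep_def mat.free_eval_add distrib_left)
qed

definition rep_entry :: "complex \<Rightarrow> bool \<Rightarrow> bool \<Rightarrow> S3 \<Rightarrow> complex" where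
  "rep_entry x a c w = entry a c (prod_list (map (T_matrix x) (reduced_word w)))"

lemma functional_rep_entry_word:
  assumes "x \<in> {1, v\<^sup>2, inverse (v\<^sup>2)}"
  shows "functional (rep_entry x a c) (hecke_word ws) = entry a c (reflection_word (t + inverse t) x ws)"
  unfolding hecke_rep_word[OF assms, symmetric]
  by (simp add: functional_def rep_entry_def hecke_rep_def entry_sum mat_scale_def)

lemma tensor_functional_rep_entry:
  fixes x :: "'k::finite \<Rightarrow> complex"
  assumes x: "\<And>i. x i \<in> {1, v\<^sup>2, inverse (v\<^sup>2)}"
  shows "tensor_functional (\<lambda>i. rep_entry (x i) a c) (hecke_tensor.free_eval nonstd_gen p) =
    entry a c (rep CARD('k) (\<Prod>i\<in>UNIV. x i) p)"
  using tensor_functional_free_eval[where g = 1 and \<phi> = "\<lambda>i. rep_entry (x i) a c"]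
  by (simp add: tensor_functional_tensor functional_rep_entry_word[OF x] prod_entry_reflection_word)

text \<open>With two different columns present, every word has the wrong parity for some tensor
  factor.\<close>

lemma tensor_functional_rep_entry_mixed:
  fixes x :: "'k::finite \<Rightarrow> complex"
  assumes x: "\<And>i. x i \<in> {1, v\<^sup>2, inverse (v\<^sup>2)}" and "c i \<noteq> c j"
  shows "tensor_functional (\<lambda>i. rep_entry (x i) a (c i)) (hecke_tensor.free_eval nonstd_gen p) = 0"
proof -
  have "(\<Prod>i\<in>UNIV. entry a (c i) (reflection_word (t + inverse t) (x i) ws)) = 0" for ws
  proof -
    obtain l where "(a = c l) \<noteq> even (length ws)"
      using \<open>c i \<noteq> c j\<close> by metis
    then have "entry a (c l) (reflection_word (t + inverse t) (x l) ws) = 0"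
      by (rule entry_reflection_word_eq_0)
    then show ?thesis
      by (intro prod_zero) auto
  qed
  then show ?thesis
    using tensor_functional_free_eval[where g = 0 and \<phi> = "\<lambda>i. rep_entry (x i) a (c i)"]
    by (simp add: tensor_functional_tensor functional_rep_entry_word[OF x])
qed

end

text \<open>Taking the eigenvalue v^2 in \<open>j\<close> factors and 1 in the others expresses the
  entries of \<open>rep\<close> through functionals on the tensor power.\<close>

lemma (in specialization) rep_eq_0:
  assumes "hecke_tensor.free_eval (nonstd_gen :: simple_refl \<Rightarrow> 'k::finite hecke_tensor) p = 0"
    and "j \<le> CARD('k)"
  shows "rep CARD('k) (v ^ (2 * j)) p = 0"
proof -
  obtain A :: "'k set" where A: "card A = j"
    using obtain_subset_with_card_n[OF assms(2)] by metis
  define x where "x = (\<lambda>i. if i \<in> A then v\<^sup>2 else 1)"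
  have "(\<Prod>i\<in>UNIV. x i) = v ^ (2 * j)"
    by (simp add: x_def prod.If_cases A power_mult)
  moreover have "x i \<in> {1, v\<^sup>2, inverse (v\<^sup>2)}" for i
    by (simp add: x_def)
  ultimately show ?thesis
    using tensor_functional_rep_entry[of x _ _ p] unfolding assms(1) mat2_eq_0_iff
    by (simp add: tensor_functional_0)
qed

section \<open>Faithfulness\<close>

lemma vandermonde3:
  fixes z :: complex
  assumes "z \<noteq> 0" "z\<^sup>2 \<noteq> 1"
  shows "\<exists>d. d 1 + d z + d (inverse z) = A \<and> d 1 + d z * z + d (inverse z) * inverse z = B \<and>
    d 1 + d z * inverse z + d (inverse z) * z = C"
proof -
  define y where "y = inverse z"
  have zy: "z * y = 1"
    using assms by (simp add: y_def)
  have nz: "z - y \<noteq> 0" "z + y - 2 \<noteq> 0"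
  proof -
    show "z - y \<noteq> 0"
      using assms by (auto simp: y_def field_simps power2_eq_square)
    have "z * (z + y - 2) = (z - 1)\<^sup>2"
      using zy by (simp add: algebra_simps power2_eq_square)
    then show "z + y - 2 \<noteq> 0"
      using assms by auto
  qed
  have distinct: "z \<noteq> 1" "y \<noteq> 1" "y \<noteq> z"
    using assms nz by (auto simp: y_def)
  \<comment> \<open>The sum and the difference of the unknowns \<open>d z\<close> and
    \<open>d (inverse z)\<close>, for which the system decouples.\<close>
  define e f where "e = (B + C - 2 * A) / (z + y - 2)" and "f = (B - C) / (z - y)"
  have e: "e * (z + y - 2) = B + C - 2 * A" and f: "f * (z - y) = B - C"
    using nz by (simp_all add: e_def f_def)
  define d where "d = (\<lambda>w. if w = 1 then A - e else if w = z then (e + f) / 2 else (e - f) / 2)"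
  have d_eq: "d 1 = A - e" "d z = (e + f) / 2" "d y = (e - f) / 2"
    using distinct by (simp_all add: d_def)
  have sums: "A - e + (e + f) / 2 * z + (e - f) / 2 * y = A + (e * (z + y - 2) + f * (z - y)) / 2"
    "A - e + (e + f) / 2 * y + (e - f) / 2 * z = A + (e * (z + y - 2) - f * (z - y)) / 2"
    "A - e + (e + f) / 2 + (e - f) / 2 = A"
    by (simp_all add: field_simps)
  have "d 1 + d z + d y = A \<and> d 1 + d z * z + d y * y = B \<and> d 1 + d z * y + d y * z = C"
    unfolding d_eq sums e f by (simp add: field_simps)
  then show ?thesis
    unfolding y_def by blast
qed

section \<open>Matrix entries span the dual of the Hecke algebra\<close>

context specialization
begin

lemma v2: "v\<^sup>2 \<noteq> 0" "(v\<^sup>2)\<^sup>2 \<noteq> 1" "v\<^sup>2 \<noteq> 1" "inverse (v\<^sup>2) \<noteq> 1" "inverse (v\<^sup>2) \<noteq> v\<^sup>2"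
proof -
  show nz: "v\<^sup>2 \<noteq> 0" and one: "v\<^sup>2 \<noteq> 1" and 4: "(v\<^sup>2)\<^sup>2 \<noteq> 1"
    using v_neq_0 v_power[of 2] v_power[of 4] by simp_all
  show "inverse (v\<^sup>2) \<noteq> 1"
    using one by (metis inverse_1 inverse_inverse_eq)
  show "inverse (v\<^sup>2) \<noteq> v\<^sup>2"
    using 4 nz by (metis power2_eq_square right_inverse)
qed

lemma T_word_perm:
  "T (word_perm [s]) = T (refl_perm s)" "T (word_perm []) = 1"
  "T (word_perm [s1, s2]) = T (refl_perm s1) * T (refl_perm s2)"
  "T (word_perm [s2, s1]) = T (refl_perm s2) * T (refl_perm s1)"
  "T (word_perm [s1, s2, s1]) = T (refl_perm s1) * (T (refl_perm s2) * T (refl_perm s1))"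
proof -
  have Cons: "T (word_perm (s # ws)) = T (refl_perm s) * T (word_perm ws)"
    if "len (word_perm (s # ws)) = len (word_perm [s]) + len (word_perm ws)" for s ws
    using that by (simp add: T_mult word_perm_Cons word_perm_Nil)
  show 1: "T (word_perm [s]) = T (refl_perm s)" for s
    by (simp add: word_perm_Cons word_perm_Nil)
  show "T (word_perm []) = 1"
    by (simp add: word_perm_Nil one_hecke3_def)
  show "T (word_perm [s1, s2]) = T (refl_perm s1) * T (refl_perm s2)"
    by (simp add: Cons[of s1 "[s2]"] len_word_perm 1)
  show 21: "T (word_perm [s2, s1]) = T (refl_perm s2) * T (refl_perm s1)"
    by (simp add: Cons[of s2 "[s1]"] len_word_perm 1)
  show "T (word_perm [s1, s2, s1]) = T (refl_perm s1) * (T (refl_perm s2) * T (refl_perm s1))"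
    by (simp add: Cons[of s1 "[s2, s1]"] len_word_perm 21)
qed

text \<open>Since 2 T = \<tau> + (u - 1/u), the letters \<tau> can be replaced by T one at a time,
  modulo words with that letter deleted.\<close>

lemma functional_eq_0:
  assumes "\<And>ws. ws \<in> {[], [s1], [s2], [s1, s2], [s2, s1], [s1, s2, s1]} \<Longrightarrow>
    functional \<phi> (hecke_word ws) = 0"
  shows "\<phi> w = 0"
proof -
  have half: "functional \<phi> (a * (T (refl_perm s) * c)) = 0"
    if "functional \<phi> (a * (hecke_refl s * c)) = 0" "functional \<phi> (a * c) = 0" for a s c
  proof -
    have "a * (hecke_refl s * c) = a * (T (refl_perm s) * c) + a * (T (refl_perm s) * c)
        - hecke_scale (u - u_inv) (a * c)"
      by (simp only: hecke_refl_eq distrib_left distrib_right right_diff_distrib left_diff_distrib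
          hecke3.scale_mult_left hecke3.scale_mult_right mult_1_left)
    from arg_cong[OF this, of "functional \<phi>"] that show ?thesis
      by (simp only: functional_add functional_diff functional_scale) simp
  qed
  let ?r1 = "hecke_refl s1" and ?r2 = "hecke_refl s2"
  have 0: "functional \<phi> 1 = 0" "functional \<phi> ?r1 = 0" "functional \<phi> ?r2 = 0"
    "functional \<phi> (?r1 * ?r2) = 0" "functional \<phi> (?r2 * ?r1) = 0" "functional \<phi> (?r1 * (?r2 * ?r1)) = 0"
    using assms[of "[]"] assms[of "[s1]"] assms[of "[s2]"] assms[of "[s1, s2]"] assms[of "[s2, s1]"]
      assms[of "[s1, s2, s1]"] by (simp_all add: hecke_word_def)
  \<comment> \<open>Needed when the middle letter of s1 s2 s1 is deleted.\<close>
  have sq: "functional \<phi> (hecke_refl s * hecke_refl s) = 0" for s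
    by (simp add: hecke_refl_square functional_scale 0)
  let ?T1 = "T (refl_perm s1)" and ?T2 = "T (refl_perm s2)"
  have T: "functional \<phi> ?T1 = 0" "functional \<phi> ?T2 = 0"
    using half[of 1 _ 1] 0 by simp_all
  have rT: "functional \<phi> (?r1 * ?T2) = 0" "functional \<phi> (?r2 * ?T1) = 0" "functional \<phi> (?r1 * ?T1) = 0"
    using half[of _ _ 1] 0 sq by simp_all
  have TT: "functional \<phi> (?T1 * ?T2) = 0" "functional \<phi> (?T2 * ?T1) = 0"
    using half[of 1] rT T by simp_all
  have "functional \<phi> (?r1 * (?r2 * ?T1)) = 0"
    using half[of "?r1 * ?r2" s1 1] 0 by (simp add: mult.assoc)
  then have "functional \<phi> (?r1 * (?T2 * ?T1)) = 0"
    using half[of ?r1 s2 ?T1] rT by simp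
  then have "functional \<phi> (?T1 * (?T2 * ?T1)) = 0"
    using half[of 1 s1 "?T2 * ?T1"] TT by simp
  note this 0(1) T TT
  then have "\<forall>w. functional \<phi> (T w) = 0"
    unfolding all_S3 T_word_perm by simp
  then show ?thesis
    by (simp add: functional_T)
qed

text \<open>A functional is determined by six words in \<tau>. Even words see only the column
  \<open>True\<close> and odd words only \<open>False\<close>, which splits the problem into two
  three-point systems.\<close>

lemma rep_entry_span:
  "\<exists>d. \<forall>w. \<phi> w = (\<Sum>(x, c)\<in>{1, v\<^sup>2, inverse (v\<^sup>2)} \<times> UNIV. d x c * rep_entry x True c w)"
proof -
  define z b where "z = v\<^sup>2" and "b = t + inverse t"
  have z: "z \<noteq> 0" "z\<^sup>2 \<noteq> 1" "z \<noteq> 1" "inverse z \<noteq> 1" "inverse z \<noteq> z"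
    using v2 by (simp_all add: z_def)
  have "b \<noteq> 0"
    using eval_two_q_neq_0 by (simp add: b_def)
  let ?F = "\<lambda>ws. functional \<phi> (hecke_word ws)"
  obtain d where d: "d 1 + d z + d (inverse z) = ?F []"
    "d 1 + d z * z + d (inverse z) * inverse z = ?F [s2, s1] / b\<^sup>2"
    "d 1 + d z * inverse z + d (inverse z) * z = ?F [s1, s2] / b\<^sup>2"
    using vandermonde3[OF z(1,2)] by metis
  obtain e where e: "e 1 + e z + e (inverse z) = ?F [s1] / b"
    "e 1 + e z * z + e (inverse z) * inverse z = ?F [s2] / b"
    "e 1 + e z * inverse z + e (inverse z) * z = ?F [s1, s2, s1] / b ^ 3"
    using vandermonde3[OF z(1,2)] by metis
  define D where "D x c = (if c then d x else e x)" for x and c :: bool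
  define \<psi> where "\<psi> w = (\<Sum>(x, c)\<in>{1, z, inverse z} \<times> UNIV. D x c * rep_entry x True c w)" for w
  have \<psi>: "functional \<psi> h = (\<Sum>(x, c)\<in>{1, z, inverse z} \<times> UNIV. D x c * functional (rep_entry x True c) h)" for h
    unfolding functional_def \<psi>_def sum_distrib_left
    by (subst sum.swap) (simp add: case_prod_unfold sum_distrib_left mult_ac)
  have "functional \<psi> (hecke_word ws) =
      (\<Sum>(x, c)\<in>{1, z, inverse z} \<times> UNIV. D x c * entry True c (reflection_word b x ws))" for ws
    unfolding \<psi> by (rule sum.cong) (auto simp: functional_rep_entry_word z_def b_def)
  also have "\<dots> ws = (d 1 * entry True True (reflection_word b 1 ws) + e 1 * entry True False (reflection_word b 1 ws))
      + (d z * entry True True (reflection_word b z ws) + e z * entry True False (reflection_word b z ws))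
      + (d (inverse z) * entry True True (reflection_word b (inverse z) ws)
         + e (inverse z) * entry True False (reflection_word b (inverse z) ws))" for ws
    using z by (simp add: sum.cartesian_product[symmetric] UNIV_bool D_def add_ac)
  finally have val: "functional \<psi> (hecke_word ws) = \<dots> ws" for ws .
  have "functional \<psi> (hecke_word ws) = ?F ws"
    if "ws \<in> {[], [s1], [s2], [s1, s2], [s2, s1], [s1, s2, s1]}" for ws
  proof -
    have nil: "entry a c (reflection_word b x []) = (if a = c then 1 else 0)" for a c x
      by (simp add: reflection_word_def)
    note simps = val entry_reflection_word_Cons nil
    have "functional \<psi> (hecke_word []) = d 1 + d z + d (inverse z)"
      "functional \<psi> (hecke_word [s1]) = b * (e 1 + e z + e (inverse z))"
      "functional \<psi> (hecke_word [s2]) = b * (e 1 + e z * z + e (inverse z) * inverse z)"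
      "functional \<psi> (hecke_word [s1, s2]) = b\<^sup>2 * (d 1 + d z * inverse z + d (inverse z) * z)"
      "functional \<psi> (hecke_word [s2, s1]) = b\<^sup>2 * (d 1 + d z * z + d (inverse z) * inverse z)"
      "functional \<psi> (hecke_word [s1, s2, s1]) = b ^ 3 * (e 1 + e z * inverse z + e (inverse z) * z)"
      by (simp_all add: simps algebra_simps power2_eq_square power3_eq_cube)
    with that \<open>b \<noteq> 0\<close> show ?thesis
      unfolding d e by auto
  qed
  then have "functional (\<lambda>w. \<phi> w - \<psi> w) (hecke_word ws) = 0"
    if "ws \<in> {[], [s1], [s2], [s1, s2], [s2, s1], [s1, s2, s1]}" for ws
    using that by (simp add: functional_def right_diff_distrib sum_subtractf)
  from functional_eq_0[OF this] have "\<phi> w = \<psi> w" for w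
    by simp
  then show ?thesis
    unfolding \<psi>_def z_def by blast
qed

text \<open>Each factor contributes an exponent -1, 0 or 1 of v^2; the absolute value of their sum
  is \<open>j\<close>.\<close>

lemma prod_v_powers:
  assumes "finite A" "\<And>i. i \<in> A \<Longrightarrow> x i \<in> {1, v\<^sup>2, inverse (v\<^sup>2)}"
  shows "\<exists>j\<le>card A. prod x A = v ^ (2 * j) \<or> prod x A = inverse (v ^ (2 * j))"
proof -
  have "\<exists>m::int. \<bar>m\<bar> \<le> int (card A) \<and> prod x A = (v\<^sup>2) powi m"
    using assms
  proof (induction A)
    case (insert i A)
    then obtain m where m: "\<bar>m\<bar> \<le> int (card A)" "prod x A = (v\<^sup>2) powi m"
      by (meson insertI2)
    obtain n :: int where n: "\<bar>n\<bar> \<le> 1" "x i = (v\<^sup>2) powi n"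
      using insert.prems[OF insertI1] that[of 0] that[of 1] that[of "- 1"]
      unfolding power_int_minus power_int_0_right power_int_1_right by fastforce
    have "\<bar>n + m\<bar> \<le> int (card (insert i A))"
      using m(1) n(1) insert.hyps by simp
    moreover have "prod x (insert i A) = (v\<^sup>2) powi (n + m)"
      using m(2) n(2) insert.hyps v2(1) by (simp add: power_int_add)
    ultimately show ?case by blast
  qed auto
  then obtain m where m: "\<bar>m\<bar> \<le> int (card A)" "prod x A = (v\<^sup>2) powi m"
    by blast
  have "prod x A = v ^ (2 * nat \<bar>m\<bar>) \<or> prod x A = inverse (v ^ (2 * nat \<bar>m\<bar>))"
    unfolding m(2) power_int_def by (auto simp: power_mult power_inverse)
  with m(1) show ?thesis
    by (intro exI[of _ "nat \<bar>m\<bar>"]) auto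
qed

text \<open>A coefficient is a tensor product of coordinate functionals. Expanding each by
  \<open>rep_entry_span\<close> leaves terms with mixed columns, which vanish by parity, and entries
  of \<open>rep\<close>, which vanish by assumption.\<close>

lemma eval_coeff_eq_0:
  fixes w :: "'k::finite \<Rightarrow> S3"
  assumes rep: "\<And>j x. j \<le> CARD('k) \<Longrightarrow> x = v ^ (2 * j) \<or> x = inverse (v ^ (2 * j)) \<Longrightarrow> rep CARD('k) x p = 0"
  shows "laurent_eval t (tensor_coeff (hecke_tensor.free_eval nonstd_gen p) w) = 0"
proof -
  let ?X = "hecke_tensor.free_eval nonstd_gen p :: 'k hecke_tensor"
  let ?I = "{1, v\<^sup>2, inverse (v\<^sup>2)} \<times> (UNIV :: bool set)"
  have "\<forall>i. \<exists>d. \<forall>w'. (if w' = w i then 1 else 0) = (\<Sum>(x, c)\<in>?I. d x c * rep_entry x True c w')"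
    by (rule allI) (rule rep_entry_span)
  from choice[OF this] obtain d where d: "\<And>i w'. (if w' = w i then 1 else 0) =
      (\<Sum>y\<in>?I. d i (fst y) (snd y) * rep_entry (fst y) True (snd y) w')"
    unfolding case_prod_unfold by blast
  have summand: "tensor_functional (\<lambda>i. rep_entry (fst (\<eta> i)) True (snd (\<eta> i))) ?X = 0"
    if "\<eta> \<in> PiE UNIV (\<lambda>_. ?I)" for \<eta>
  proof -
    have x: "fst (\<eta> i) \<in> {1, v\<^sup>2, inverse (v\<^sup>2)}" for i
      using PiE_mem[OF that, of i] by (auto simp: mem_Times_iff)
    show ?thesis
    proof (cases "\<exists>i j. snd (\<eta> i) \<noteq> snd (\<eta> j)")
      case True
      then obtain i j where "snd (\<eta> i) \<noteq> snd (\<eta> j)"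
        by (elim exE)
      then show ?thesis
        by (rule tensor_functional_rep_entry_mixed[of "\<lambda>i. fst (\<eta> i)" "\<lambda>i. snd (\<eta> i)", OF x])
    next
      case False
      \<comment> \<open>\<open>undefined\<close> serves as an arbitrary tensor position; all columns
        agree in this case.\<close>
      define c where "c = snd (\<eta> undefined)"
      have c: "snd (\<eta> i) = c" for i
        using False unfolding c_def by simp
      obtain j where "j \<le> CARD('k)" "(\<Prod>i\<in>UNIV. fst (\<eta> i)) = v ^ (2 * j) \<or>
          (\<Prod>i\<in>UNIV. fst (\<eta> i)) = inverse (v ^ (2 * j))"
        using prod_v_powers[of UNIV "\<lambda>i. fst (\<eta> i)", OF finite x] by (elim exE conjE)
      then have "rep CARD('k) (\<Prod>i\<in>UNIV. fst (\<eta> i)) p = 0"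
        by (rule rep)
      then show ?thesis
        using tensor_functional_rep_entry[of "\<lambda>i. fst (\<eta> i)" True c p, OF x] by (simp add: c)
    qed
  qed
  have "laurent_eval t (tensor_coeff ?X w) =
      tensor_functional (\<lambda>i w'. if w' = w i then 1 else 0) ?X"
  proof -
    have "(\<Prod>i\<in>UNIV. if w' i = w i then 1 else (0 :: complex)) = (if w' = w then 1 else 0)" for w'
      by (auto simp: fun_eq_iff)
    then show ?thesis
      by (simp add: tensor_functional_def if_distrib[of "\<lambda>a. _ * a"] cong: if_cong)
  qed
  \<comment> \<open>The product of the expansions is multiplied out over all choices \<eta> of a
    summand in each factor.\<close>
  also have "\<dots> = (\<Sum>w'\<in>UNIV. \<Sum>\<eta>\<in>PiE UNIV (\<lambda>_. ?I). (\<Prod>i\<in>UNIV. d i (fst (\<eta> i)) (snd (\<eta> i))) *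
      (laurent_eval t (tensor_coeff ?X w') * (\<Prod>i\<in>UNIV. rep_entry (fst (\<eta> i)) True (snd (\<eta> i)) (w' i))))"
    unfolding tensor_functional_def d
    by (subst prod_sum_PiE) (simp_all add: prod.distrib sum_distrib_left mult_ac)
  also have "\<dots> = (\<Sum>\<eta>\<in>PiE UNIV (\<lambda>_. ?I). (\<Prod>i\<in>UNIV. d i (fst (\<eta> i)) (snd (\<eta> i))) *
      tensor_functional (\<lambda>i. rep_entry (fst (\<eta> i)) True (snd (\<eta> i))) ?X)"
    unfolding tensor_functional_def sum_distrib_left by (rule sum.swap)
  also have "\<dots> = 0"
    by (intro sum.neutral ballI) (simp add: summand)
  finally show ?thesis .
qed

end

section \<open>The presentation\<close>

lemma free_eval_relations:
  assumes "r \<in> nonstd_relations (two_q ^ CARD('k)) (braid_poly CARD('k))"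
  shows "hecke_tensor.free_eval (nonstd_gen :: simple_refl \<Rightarrow> 'k::finite hecke_tensor) r = 0"
proof (rule tensor_eqI)
  fix w :: "'k \<Rightarrow> S3"
  \<comment> \<open>The relations hold in the matrix representations, and these detect every
    specialized coefficient.\<close>
  have "laurent_eval t (tensor_coeff (hecke_tensor.free_eval nonstd_gen r) w) = 0"
    if "specialization t v" for t v
  proof -
    interpret specialization t v by fact
    show ?thesis
      by (rule eval_coeff_eq_0) (rule rep_relations[OF assms])
  qed
  then show "tensor_coeff (hecke_tensor.free_eval nonstd_gen r) w = tensor_coeff 0 w"
    by (simp add: laurent_eq_0_iff_eval zero_hecke_tensor_def)
qed

theorem theorem3p7:
  shows "hecke_tensor.has_presentation
    (nonstd_hecke :: 'k::finite hecke_tensor set) nonstd_gen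
    ({free_var s * free_var s - free_scale (two_q ^ CARD('k)) (free_var s) | s. True} \<union>
     {free_var s1 * free_algebra.poly_eval (braid_poly CARD('k)) (free_var s2 * free_var s1) -
      free_var s2 * free_algebra.poly_eval (braid_poly CARD('k)) (free_var s1 * free_var s2)})"
  unfolding hecke_tensor.has_presentation_def nonstd_relations_def[symmetric]
proof (intro conjI equalityI subsetI)
  let ?R = "nonstd_relations (two_q ^ CARD('k)) (braid_poly CARD('k))"
  let ?ev = "hecke_tensor.free_eval (nonstd_gen :: simple_refl \<Rightarrow> 'k hecke_tensor)"
  have ideal: "?ev p = 0" if "p \<in> two_sided_ideal ?R" for p
    using that by (rule hecke_tensor.free_eval_two_sided_ideal) (rule free_eval_relations)
  show "p \<in> {p. ?ev p = 0}" if "p \<in> two_sided_ideal ?R" for p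
    using ideal[OF that] by simp
  show "p \<in> two_sided_ideal ?R" if "p \<in> {p. ?ev p = 0}" for p
  proof -
    obtain \<alpha> P Q R S where form: "ideal_cong ?R p (alternating_form \<alpha> P Q R S)"
      using ex_alternating_form by blast
    \<comment> \<open>An element and its normal form differ by an element of the ideal, so both lie
      in the kernel.\<close>
    then have "?ev (alternating_form \<alpha> P Q R S) = 0"
      using ideal[of "p - alternating_form \<alpha> P Q R S"] that
      by (simp add: ideal_cong_def hecke_tensor.free_eval_diff)
    then have "alternating_form \<alpha> P Q R S \<in> two_sided_ideal ?R"
      by (intro alternating_form_zero specialization.rep_eq_0)
    with form show ?thesis
      using two_sided_ideal.add[of "p - alternating_form \<alpha> P Q R S" ?R] by (fastforce simp: ideal_cong_def)
  qed
qed (simp_all add: hecke_tensor.range_free_eval nonstd_hecke_def)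

end
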